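(* Let $(X,\mathcal{B},\mu)$ be a finite non-atomic measure space and let $T:X\to X$ be an ergodic measure preserving transformation of $(X,\mathcal{B},\mu)$. Then there exist functions $f,g$, both in $L^1_+(X)$, for which the maximal function $$R^*(f,g)(x)=\sup_{n\ge 1}\frac{f(T^nx)\,g(T^{2n}x)}{n}$$ is not finite $\mu$-almost everywhere.
   Context: $L^1_+(X)$ denotes the set of nonnegative integrable functions on $(X,\mathcal{B},\mu)$. "Not finite $\mu$-almost everywhere" means that it is false that $R^*(f,g)(x)<\infty$ for $\mu$-a.e. $x$. The supremum is over positive integers $n$. *)

theory Defs
  imports "HOL-Analysis.Analysis"
begin

definition atom_of :: "'a measure \<Rightarrow> 'a set \<Rightarrow> bool" where
  "atom_of M A \<longleftrightarrow> A \<in> sets M \<and> emeasure M A > 0 \<and>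
     (\<forall>B\<in>sets M. B \<subseteq> A \<longrightarrow> emeasure M B < emeasure M A \<longrightarrow> emeasure M B = 0)"

definition non_atomic :: "'a measure \<Rightarrow> bool" where
  "non_atomic M \<longleftrightarrow> (\<nexists>A. atom_of M A)"

definition measure_preserving :: "'a measure \<Rightarrow> ('a \<Rightarrow> 'a) \<Rightarrow> bool" where
  "measure_preserving M T \<longleftrightarrow> T \<in> measurable M M \<and>
     (\<forall>A\<in>sets M. emeasure M (T -` A \<inter> space M) = emeasure M A)"

definition ergodic :: "'a measure \<Rightarrow> ('a \<Rightarrow> 'a) \<Rightarrow> bool" where
  "ergodic M T \<longleftrightarrow> measure_preserving M T \<and>
     (\<forall>A\<in>sets M. T -` A \<inter> space M = A \<longrightarrow>
        emeasure M A = 0 \<or> emeasure M (space M - A) = 0)"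

definition L1_plus :: "'a measure \<Rightarrow> ('a \<Rightarrow> real) set" where
  "L1_plus M = {f. integrable M f \<and> (\<forall>x\<in>space M. 0 \<le> f x)}"

(* Valued in [0, \<infinity>]; for f and g nonnegative along the orbit of x the
   embedding ennreal does not truncate. *)
definition R_star ::
    "('a \<Rightarrow> 'a) \<Rightarrow> ('a \<Rightarrow> real) \<Rightarrow> ('a \<Rightarrow> real) \<Rightarrow> 'a \<Rightarrow> ennreal" where
  "R_star T f g x =
     (SUP n\<in>{1::nat..}. ennreal (f ((T ^^ n) x) * g ((T ^^ (2 * n)) x) / real n))"

end

theory Submission
  imports Defs
begin

text \<open>
  A pair \<open>f, g\<close> with \<open>R_star = \<infinity>\<close> on a set of positive measure is a series of pairs with summable
  integrals, each of which is large on a set whose measure is bounded below. So it is enough to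
  find, for every \<open>\<epsilon> > 0\<close>, functions \<open>f, g\<close> with integrals at most \<open>\<epsilon>\<close> such that
  \<open>f (T^n x) * g (T^(2n) x) \<ge> n\<close> for some \<open>n \<ge> 1\<close> on a fixed proportion of the space. Reading a
  function on the integers along the orbits, indexed by the time still to go until a visit to a
  very small set, turns this into a question about nonnegative periodic functions \<open>F, G\<close> on the
  integers (\<open>pattern_transfer\<close>): small means, but \<open>F (t - n) * G (t - 2n) \<ge> n\<close> for some \<open>n\<close>, for a
  fixed proportion of all \<open>t\<close>.

  Choose \<open>F = h\<close> on a random set that contains \<open>u\<close> with probability \<open>\<delta> / h u\<close>, and \<open>G = Q / h\<close> on an
  independent random set that contains \<open>v\<close> with probability \<open>\<delta> * h v / Q\<close>. Both means are \<open>\<delta>\<close>,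
  whatever \<open>h\<close> is. When both sets are met, the product at \<open>(u, v) = (t - n, t - 2n)\<close> is the level
  \<open>Q * h u / h v\<close>, and they are met with probability \<open>\<delta>\<^sup>2\<close> divided by that level. For one \<open>t\<close> the
  events for different \<open>n\<close> are independent, so \<open>t\<close> is missed with probability at most
  \<open>exp (- \<delta>\<^sup>2 * S t)\<close>, where \<open>S t\<close> adds up the reciprocals of the levels over those \<open>n\<close> that do not
  exceed their level (\<open>hit_mass\<close>). Everything depends on a function \<open>h\<close> for which \<open>S\<close> is
  large at most points (\<open>multiscale_heights\<close>).

  For constant \<open>h\<close> the sum \<open>S\<close> is about 1, and it is a sum over a single scale of \<open>n\<close>. Now multiply
  \<open>h\<close> by a huge factor \<open>R\<close> on every fourth window of a long periodic subdivision. Inside a window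
  the ratios \<open>h u / h v\<close> are unchanged, so the old terms survive, except for \<open>t\<close> close to the
  beginning of a window. If \<open>u\<close> is in a raised window and \<open>v\<close> is not, then the level has become
  \<open>R\<close> times larger; this creates new terms with \<open>n\<close> up to the order of \<open>Q * R\<close>, and they contribute
  a fixed amount, because a level \<open>Y\<close> admits about \<open>Y\<close> values of \<open>n\<close>, each of weight \<open>1 / Y\<close>.
  Hence \<open>S\<close> grows by a constant with every new scale (\<open>hit_mass_step\<close>).
\<close>

section \<open>Selecting sparse sets\<close>

text \<open>
  The elementary form of the probabilistic method: \<open>p\<close> is the vector of probabilities of independent
  choices, and \<open>\<Phi> p\<close> is the expectation of \<open>\<Phi>\<close> when \<open>\<Phi>\<close> is affine in every coordinate. Rounding one
  coordinate after the other, an affine function on \<open>[0, 1]\<close> does not increase towards at least one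
  of the two ends.
\<close>

lemma affine_vertex:
  fixes \<Phi> :: "('i \<Rightarrow> real) \<Rightarrow> real"
  assumes "finite I"
    and aff: "\<And>x i. i \<in> I \<Longrightarrow> \<exists>a b. \<forall>s. \<Phi> (x(i := s)) = a + b * s"
    and "\<And>i. i \<in> I \<Longrightarrow> 0 \<le> p i \<and> p i \<le> 1"
  shows "\<exists>x. (\<forall>i\<in>I. x i = 0 \<or> x i = 1) \<and> (\<forall>i. i \<notin> I \<longrightarrow> x i = p i) \<and> \<Phi> x \<le> \<Phi> p"
  using assms
proof (induction I rule: finite_induct)
  case empty
  then show ?case by auto
next
  case (insert j I)
  obtain x where x: "\<forall>i\<in>I. x i = 0 \<or> x i = 1" "\<forall>i. i \<notin> I \<longrightarrow> x i = p i" "\<Phi> x \<le> \<Phi> p"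
    using insert.IH insert.prems by (metis insert_iff)
  obtain a b where ab: "\<And>s. \<Phi> (x(j := s)) = a + b * s"
    using insert.prems(1)[of j x] by (auto simp del: fun_upd_apply)
  have xj: "x j = p j" using x(2) insert.hyps by auto
  have pj: "0 \<le> p j" "p j \<le> 1" using insert.prems(2) by auto
  have "\<Phi> x = a + b * p j" using ab[of "x j"] xj by (metis fun_upd_triv)
  moreover have "b * 0 \<le> b * p j \<or> b * 1 \<le> b * p j"
    using pj by (cases "b \<ge> 0") (auto simp: mult_le_cancel_left2)
  ultimately obtain e where e: "e = 0 \<or> e = 1" "\<Phi> (x(j := e)) \<le> \<Phi> x"
    using ab by (metis add_left_mono)
  show ?case
  proof (intro exI conjI)
    show "\<forall>i\<in>insert j I. (x(j := e)) i = 0 \<or> (x(j := e)) i = 1"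
      using x(1) e(1) by auto
    show "\<forall>i. i \<notin> insert j I \<longrightarrow> (x(j := e)) i = p i"
      using x(2) by auto
    show "\<Phi> (x(j := e)) \<le> \<Phi> p"
      using e(2) x(3) by linarith
  qed
qed

text \<open>
  By injectivity a single coordinate enters at most one factor.
\<close>

lemma affine_prod:
  fixes x :: "'i \<Rightarrow> real" and c :: "'n \<Rightarrow> real"
  assumes "finite D" "inj_on a D"
  shows "\<exists>A B. \<forall>s. (\<Prod>n\<in>D. 1 - (x(i := s)) (a n) * c n) = A + B * s"
proof (cases "i \<in> a ` D")
  case True
  then obtain m where m: "m \<in> D" "a m = i" by auto
  define K where "K = (\<Prod>n\<in>D - {m}. 1 - x (a n) * c n)"
  have "(\<Prod>n\<in>D. 1 - (x(i := s)) (a n) * c n) = K + (- c m * K) * s" for s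
  proof -
    have "(\<Prod>n\<in>D - {m}. 1 - (x(i := s)) (a n) * c n) = K"
      unfolding K_def using m assms by (intro prod.cong) (auto dest: inj_onD)
    then show ?thesis
      using m assms by (simp add: prod.remove[of D m] algebra_simps)
  qed
  then show ?thesis by blast
next
  case False
  then have "(\<Prod>n\<in>D. 1 - (x(i := s)) (a n) * c n) = (\<Prod>n\<in>D. 1 - x (a n) * c n) + 0 * s" for s
    by (auto intro!: prod.cong)
  then show ?thesis by blast
qed

lemma affine_sum:
  fixes \<phi> :: "'t \<Rightarrow> real \<Rightarrow> real"
  assumes "\<And>t. t \<in> G \<Longrightarrow> \<exists>a b. \<forall>s. \<phi> t s = a + b * s"
  shows "\<exists>a b. \<forall>s. (\<Sum>t\<in>G. \<phi> t s) = a + b * s"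
proof -
  obtain a b where ab: "\<And>t s. t \<in> G \<Longrightarrow> \<phi> t s = a t + b t * s"
    using assms by metis
  have "(\<Sum>t\<in>G. \<phi> t s) = sum a G + sum b G * s" for s
    using ab by (simp add: sum.distrib sum_distrib_right)
  then show ?thesis by blast
qed

lemma affine_linear:
  fixes x w :: "'i \<Rightarrow> real"
  shows "\<exists>a b. \<forall>s. (\<Sum>j\<in>I. w j * (x(i := s)) j) = a + b * s"
proof (rule affine_sum)
  fix j assume "j \<in> I"
  show "\<exists>a b. \<forall>s. w j * (x(i := s)) j = a + b * s"
  proof (cases "j = i")
    case True
    then show ?thesis by (intro exI[of _ 0] exI[of _ "w j"]) simp
  next
    case False
    then show ?thesis by (intro exI[of _ "w j * x j"] exI[of _ 0]) simp
  qed
qed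

lemma affine_add_const:
  assumes "\<exists>a b. \<forall>s. f s = a + b * s" "\<exists>a b. \<forall>s. g s = a + b * s"
  shows "\<exists>a b. \<forall>s. f s + g s + (c::real) = a + b * s"
proof -
  obtain a b a' b' where "\<And>s. f s = a + b * s" "\<And>s. g s = a' + b' * s"
    using assms by metis
  then have "\<And>s. f s + g s + c = (a + a' + c) + (b + b') * s"
    by (simp add: algebra_simps)
  then show ?thesis by blast
qed

text \<open>
  The first sum counts, for 0/1-valued \<open>\<xi>\<close> and \<open>\<zeta>\<close>, the points \<open>t\<close> for which no pair
  \<open>(a t n, b t n)\<close> is selected. So a selection exists that keeps this count together with
  the weighted sizes of both selected sets below its expectation.
\<close>

lemma sparse_selection:
  fixes p q w w' :: "'i \<Rightarrow> real" and a b :: "'t \<Rightarrow> 'n \<Rightarrow> 'i"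
    and G :: "'t set" and D :: "'t \<Rightarrow> 'n set" and I :: "'i set"
  defines "\<Phi> \<equiv> \<lambda>\<xi> \<zeta>. (\<Sum>t\<in>G. \<Prod>n\<in>D t. 1 - \<xi> (a t n) * \<zeta> (b t n))
             + (\<Sum>i\<in>I. w i * \<xi> i) + (\<Sum>i\<in>I. w' i * \<zeta> i)"
  assumes "finite I" and fin: "\<And>t. t \<in> G \<Longrightarrow> finite (D t)"
    and inj: "\<And>t. t \<in> G \<Longrightarrow> inj_on (a t) (D t)" "\<And>t. t \<in> G \<Longrightarrow> inj_on (b t) (D t)"
    and p: "\<And>i. i \<in> I \<Longrightarrow> 0 \<le> p i \<and> p i \<le> 1"
    and q: "\<And>i. i \<in> I \<Longrightarrow> 0 \<le> q i \<and> q i \<le> 1"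
  shows "\<exists>\<xi> \<zeta>. (\<forall>i\<in>I. \<xi> i = 0 \<or> \<xi> i = 1) \<and> (\<forall>i\<in>I. \<zeta> i = 0 \<or> \<zeta> i = 1) \<and> \<Phi> \<xi> \<zeta> \<le> \<Phi> p q"
proof -
  have affine_\<xi>: "\<exists>A B. \<forall>s. \<Phi> (x(i := s)) q = A + B * s" for x i
  proof -
    have 1: "\<exists>A B. \<forall>s. (\<Sum>t\<in>G. \<Prod>n\<in>D t. 1 - (x(i := s)) (a t n) * q (b t n)) = A + B * s"
    proof (rule affine_sum)
      fix t assume t: "t \<in> G"
      show "\<exists>A B. \<forall>s. (\<Prod>n\<in>D t. 1 - (x(i := s)) (a t n) * q (b t n)) = A + B * s"
        by (rule affine_prod[OF fin[OF t] inj(1)[OF t]])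
    qed
    show ?thesis
      unfolding \<Phi>_def by (rule affine_add_const[OF 1 affine_linear])
  qed
  obtain \<xi> where \<xi>: "\<forall>i\<in>I. \<xi> i = 0 \<or> \<xi> i = 1" "\<Phi> \<xi> q \<le> \<Phi> p q"
    using affine_vertex[where \<Phi> = "\<lambda>x. \<Phi> x q" and p = p, OF \<open>finite I\<close> affine_\<xi> p] by blast
  have affine_\<zeta>: "\<exists>A B. \<forall>s. \<Phi> \<xi> (x(i := s)) = A + B * s" for x i
  proof -
    have 1: "\<exists>A B. \<forall>s. (\<Sum>t\<in>G. \<Prod>n\<in>D t. 1 - (x(i := s)) (b t n) * \<xi> (a t n)) = A + B * s"
    proof (rule affine_sum)
      fix t assume t: "t \<in> G"
      show "\<exists>A B. \<forall>s. (\<Prod>n\<in>D t. 1 - (x(i := s)) (b t n) * \<xi> (a t n)) = A + B * s"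
        by (rule affine_prod[OF fin[OF t] inj(2)[OF t]])
    qed
    have eq: "\<Phi> \<xi> y = (\<Sum>t\<in>G. \<Prod>n\<in>D t. 1 - y (b t n) * \<xi> (a t n))
        + (\<Sum>i\<in>I. w' i * y i) + (\<Sum>i\<in>I. w i * \<xi> i)" for y
      unfolding \<Phi>_def by (simp add: mult.commute)
    show ?thesis
      unfolding eq by (rule affine_add_const[OF 1 affine_linear])
  qed
  obtain \<zeta> where \<zeta>: "\<forall>i\<in>I. \<zeta> i = 0 \<or> \<zeta> i = 1" "\<Phi> \<xi> \<zeta> \<le> \<Phi> \<xi> q"
    using affine_vertex[where \<Phi> = "\<Phi> \<xi>" and p = q, OF \<open>finite I\<close> affine_\<zeta> q] by blast
  show ?thesis
    by (intro exI[of _ \<xi>] exI[of _ \<zeta>] conjI \<xi>(1) \<zeta>(1) order.trans[OF \<zeta>(2) \<xi>(2)])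
qed

section \<open>Functions with hits on many scales\<close>

text \<open>
  \<open>level Q h t n\<close> is the product of the values \<open>h u\<close> and \<open>Q / h v\<close> at \<open>u = t - n\<close> and \<open>v = t - 2 * n\<close>.
  It has to reach \<open>n\<close>.
\<close>

definition level :: "nat \<Rightarrow> (int \<Rightarrow> real) \<Rightarrow> int \<Rightarrow> nat \<Rightarrow> real" where
  "level Q h t n = real Q * h (t - int n) / h (t - 2 * int n)"

definition admissible :: "nat \<Rightarrow> nat \<Rightarrow> (int \<Rightarrow> real) \<Rightarrow> int \<Rightarrow> nat set" where
  "admissible N Q h t = {n \<in> {1..N}. real n \<le> level Q h t n}"

text \<open>
  Up to a constant factor, the expected number of \<open>n\<close> that hit \<open>t\<close>.
\<close>

definition hit_mass :: "nat \<Rightarrow> nat \<Rightarrow> (int \<Rightarrow> real) \<Rightarrow> int \<Rightarrow> real" where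
  "hit_mass N Q h t = (\<Sum>n\<in>admissible N Q h t. 1 / level Q h t n)"

lemma finite_admissible [simp]: "finite (admissible N Q h t)"
  by (simp add: admissible_def)

lemma level_nonneg:
  assumes "\<And>x. 0 \<le> h x"
  shows "0 \<le> level Q h t n"
  using assms by (simp add: level_def)

lemma periodic_add_multiple:
  fixes h :: "int \<Rightarrow> 'a"
  assumes "\<And>t. h (t + p) = h t"
  shows "h (t + z * p) = h t"
proof (induction z arbitrary: t rule: int_induct[where k = 0])
  case base
  then show ?case by simp
next
  case (step1 i)
  then show ?case using assms[of "t + i * p"] by (simp add: algebra_simps)
next
  case (step2 i)
  then show ?case using assms[of "t + (i - 1) * p"] by (simp add: algebra_simps)
qed

lemma zdiv_less:
  fixes a b t :: int
  assumes "0 < b" "t < a * b"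
  shows "t div b < a"
proof -
  have "t div b * b \<le> t"
    using pos_mod_sign[OF \<open>0 < b\<close>, of t] div_mult_mod_eq[of t b] by linarith
  also have "\<dots> < a * b" by fact
  finally show ?thesis using \<open>0 < b\<close> by simp
qed

lemma card_residues_below:
  assumes "0 < b"
  shows "card {t \<in> {0..<int (a * b)}. t mod int b < int c} \<le> a * c"
proof -
  have "{t \<in> {0..<int (a * b)}. t mod int b < int c}
      \<subseteq> (\<lambda>(i, j). int (i * b + j)) ` ({..<a} \<times> {..<c})"
  proof
    fix t assume t: "t \<in> {t \<in> {0..<int (a * b)}. t mod int b < int c}"
    have pos: "0 \<le> t div int b" "0 \<le> t mod int b"
      using t assms by (auto simp: pos_imp_zdiv_nonneg_iff)
    have eq: "t = int (nat (t div int b) * b + nat (t mod int b))"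
      using pos by simp
    have "t div int b < int a"
      using t assms by (intro zdiv_less) auto
    then have "nat (t div int b) < a" "nat (t mod int b) < c" using pos t by auto
    then show "t \<in> (\<lambda>(i, j). int (i * b + j)) ` ({..<a} \<times> {..<c})"
      by (intro image_eqI[where x = "(nat (t div int b), nat (t mod int b))"]) (use eq in auto)
  qed
  then have "card {t \<in> {0..<int (a * b)}. t mod int b < int c}
      \<le> card ((\<lambda>(i, j). int (i * b + j)) ` ({..<a} \<times> {..<c}))"
    by (intro card_mono) auto
  also have "\<dots> \<le> card ({..<a} \<times> {..<c})"
    by (intro card_image_le) auto
  finally show ?thesis by (simp add: card_cartesian_product)
qed

text \<open>
  The windows have length \<open>4 * P\<close>, and one out of four is raised. With these proportions, for every
  \<open>t\<close> there is a whole interval of \<open>P\<close> consecutive raised positions \<open>t - n\<close>, in each period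
  \<open>16 * P\<close>, for which \<open>t - 2 * n\<close> is not raised.
\<close>

definition raised :: "nat \<Rightarrow> int \<Rightarrow> bool" where
  "raised P t \<longleftrightarrow> (t div (4 * int P)) mod 4 = 0"

lemma raised_shift:
  assumes "0 < P" "0 \<le> y" "y < 16 * int P"
  shows "raised P (16 * int P * z + y) \<longleftrightarrow> y < 4 * int P"
proof -
  have "(16 * int P * z + y) div (4 * int P) = 4 * z + y div (4 * int P)"
    using assms div_mult_self2[of "4 * int P" y "4 * z"] by (simp add: algebra_simps)
  moreover have "0 \<le> y div (4 * int P)" "y div (4 * int P) < 4"
    using assms by (auto simp: pos_imp_zdiv_nonneg_iff intro: zdiv_less)
  moreover have "y div (4 * int P) = 0 \<longleftrightarrow> y < 4 * int P"
    using assms by (auto simp: zdiv_eq_0_iff)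
  ultimately show ?thesis
    by (simp add: raised_def)
qed

lemma raised_periodic:
  assumes "0 < P"
  shows "raised P (t + 16 * int P) = raised P t"
proof -
  have "(t + 16 * int P) div (4 * int P) = 4 + t div (4 * int P)"
    using assms div_mult_self2[of "4 * int P" t 4] by (simp add: algebra_simps)
  then show ?thesis by (simp add: raised_def)
qed

lemma raised_same_window:
  assumes "0 < P" "0 \<le> m" "m \<le> t mod (4 * int P)"
  shows "raised P (t - m) = raised P t"
proof -
  have "t - m = 4 * int P * (t div (4 * int P)) + (t mod (4 * int P) - m)"
    by simp
  moreover have "0 \<le> t mod (4 * int P) - m" "t mod (4 * int P) - m < 4 * int P"
    using assms pos_mod_bound[of "4 * int P" t] by linarith+
  ultimately have "(t - m) div (4 * int P) = t div (4 * int P)"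
    by (metis div_pos_pos_trivial div_mult_self2 add.commute add_0 less_irrefl order_le_less_trans)
  then show ?thesis by (simp add: raised_def)
qed

text \<open>
  The raised position \<open>t - n\<close> is sought in the interval \<open>[y0, y0 + P)\<close> modulo \<open>16 * P\<close>, where \<open>y0\<close>
  is one of the two outer quarters of the raised window, chosen so that \<open>t - 2 * n\<close> is not raised.
  Since \<open>h\<close> has period \<open>P\<close>, the level \<open>Y s\<close> depends only on the offset \<open>s\<close> in this interval, and
  among the \<open>n \<le> Y s\<close> there is one with offset \<open>s\<close> in each stretch of length \<open>16 * P\<close>. That
  gives about \<open>Y s / (16 * P)\<close> terms \<open>1 / Y s\<close>; half of this, summed over \<open>P\<close> offsets, is \<open>1 / 32\<close>.
\<close>

lemma hit_mass_new_scale: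
  fixes h h' :: "int \<Rightarrow> real" and P Q R V N :: nat and t :: int
  assumes "0 < P"
    and per: "\<And>t. h (t + int P) = h t"
    and bd: "\<And>t. 1 \<le> h t" "\<And>t. h t \<le> real V"
    and R: "64 * P * V \<le> Q * R"
    and N: "Q * V * R \<le> N"
  defines "h' \<equiv> \<lambda>t. h t * (if raised P t then real R else 1)"
  defines "E \<equiv> {n \<in> admissible N Q h' t. raised P (t - int n) \<and> \<not> raised P (t - 2 * int n)}"
  shows "1 / 32 \<le> (\<Sum>n\<in>E. 1 / level Q h' t n)"
proof -
  have "1 \<le> V" using bd[of 0] by linarith
  define p where "p = int P"
  have p: "0 < p" using \<open>0 < P\<close> by (simp add: p_def)
  define \<tau> where "\<tau> = t mod (16 * p)"
  define z where "z = t div (16 * p)"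
  have t: "t = 16 * p * z + \<tau>" and \<tau>: "0 \<le> \<tau>" "\<tau> < 16 * p"
    using p by (auto simp: \<tau>_def z_def)
  \<comment> \<open>The interval \<open>[0, P)\<close> sends \<open>t - 2 * n\<close> into a raised window for some values of \<open>\<tau>\<close>;
     the interval \<open>[3 * P, 4 * P)\<close> is good for those.\<close>
  define y0 where "y0 = (if 2 * p \<le> \<tau> \<and> \<tau> < 12 * p then 0 else 3 * p)"
  define nn where "nn = (\<lambda>s i. nat (16 * p * (int i + 1) + \<tau> - y0 - int s))"
  define Y where "Y = (\<lambda>s. real Q * real R * h (y0 + int s) / h (2 * y0 + 2 * int s - \<tau>))"
  \<comment> \<open>One stretch is given up because \<open>nn s i\<close> may be as large as \<open>16 * P * (i + 2)\<close>.\<close>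
  define k where "k = (\<lambda>s. nat \<lfloor>Y s / (16 * real P)\<rfloor> - 1)"
  have y0: "0 \<le> y0" "y0 \<le> 3 * p" using p by (auto simp: y0_def)
  have per': "h (a + b * p) = h a" for a b
    using periodic_add_multiple[of h p] per by (simp add: p_def)
  have hpos: "0 < h x" for x using bd(1)[of x] by linarith
  have nn: "int (nn s i) = 16 * p * (int i + 1) + \<tau> - y0 - int s" "0 < nn s i"
    if "s < P" for s i
  proof -
    have "0 < 16 * p * (int i + 1) + \<tau> - y0 - int s"
    proof -
      have "int s < p" using that by (simp add: p_def)
      moreover have "16 * p * (int i + 1) \<ge> 16 * p * 1" using p by (intro mult_left_mono) auto
      ultimately show ?thesis using y0 \<tau> p by linarith
    qed
    then show "int (nn s i) = 16 * p * (int i + 1) + \<tau> - y0 - int s" "0 < nn s i"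
      by (auto simp: nn_def)
  qed
  have Y_lower: "64 * real P \<le> Y s" for s
  proof -
    have "64 * real P * real V \<le> real Q * real R"
      using R by (metis of_nat_le_iff of_nat_mult of_nat_numeral)
    then have "64 * real P \<le> real Q * real R / real V"
      using \<open>1 \<le> V\<close> by (simp add: field_simps)
    also have "\<dots> = real Q * real R * 1 / real V" by simp
    also have "\<dots> \<le> Y s"
      unfolding Y_def using bd hpos \<open>1 \<le> V\<close>
      by (intro frac_le mult_left_mono) (auto intro!: mult_nonneg_nonneg less_imp_le[OF hpos])
    finally show ?thesis .
  qed
  have Y_upper: "Y s \<le> real N" for s
  proof -
    have "Y s \<le> real Q * real R * real V / 1"
      unfolding Y_def using bd
      by (intro frac_le mult_left_mono) auto
    also have "\<dots> = real (Q * V * R)" by simp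
    also have "\<dots> \<le> real N" using N of_nat_le_iff by blast
    finally show ?thesis .
  qed
  have member: "nn s i \<in> E" and level: "level Q h' t (nn s i) = Y s"
    if s: "s < P" and i: "i < k s" for s i
  proof -
    have sp: "int s < p" using s by (simp add: p_def)
    have u: "t - int (nn s i) = 16 * p * (z - int i - 1) + (y0 + int s)"
      using nn(1)[OF s, of i] by (simp add: t algebra_simps)
    have ru: "raised P (t - int (nn s i))"
      unfolding u p_def using y0 sp \<open>0 < P\<close>
      by (subst raised_shift) (auto simp: p_def)
    define v where "v = 2 * y0 + 2 * int s - \<tau>"
    have v: "t - 2 * int (nn s i) = 16 * p * (z - 2 * int i - 2) + v"
      using nn(1)[OF s, of i] by (simp add: t v_def algebra_simps)
    have "- (12 * p) \<le> v \<and> v < 0 \<or> 4 * p \<le> v \<and> v < 16 * p"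
      using \<tau> sp p unfolding v_def y0_def by (auto split: if_splits)
    then have rv: "\<not> raised P (t - 2 * int (nn s i))"
    proof
      assume v': "- (12 * p) \<le> v \<and> v < 0"
      have "t - 2 * int (nn s i) = 16 * p * (z - 2 * int i - 3) + (v + 16 * p)"
        unfolding v by (simp add: algebra_simps)
      then show ?thesis
        using raised_shift[of P "v + 16 * p"] v' \<open>0 < P\<close> by (simp add: p_def)
    next
      assume "4 * p \<le> v \<and> v < 16 * p"
      then show ?thesis
        unfolding v using raised_shift[of P v] \<open>0 < P\<close> by (simp add: p_def)
    qed
    have hu: "h (t - int (nn s i)) = h (y0 + int s)"
      using per'[of "y0 + int s" "16 * (z - int i - 1)"] unfolding u by (simp add: algebra_simps)
    have hv: "h (t - 2 * int (nn s i)) = h v"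
      using per'[of v "16 * (z - 2 * int i - 2)"] unfolding v by (simp add: algebra_simps)
    show lev: "level Q h' t (nn s i) = Y s"
      using ru rv by (simp add: level_def h'_def hu hv Y_def v_def)
    have "real (nn s i) = real_of_int (16 * p * (int i + 1) + \<tau> - y0 - int s)"
      using nn(1)[OF s, of i] by (metis of_int_of_nat_eq)
    also have "\<dots> \<le> real_of_int (16 * p * (int i + 2))"
      using \<tau> y0 by (subst of_int_le_iff) (simp add: algebra_simps)
    also have "\<dots> = 16 * real P * (real i + 2)" by (simp add: p_def)
    also have "\<dots> \<le> Y s"
    proof -
      have "int i + 2 \<le> \<lfloor>Y s / (16 * real P)\<rfloor>" using i unfolding k_def by linarith
      then have "real_of_int (int i + 2) \<le> Y s / (16 * real P)" by (simp add: le_floor_iff)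
      then show ?thesis using \<open>0 < P\<close> by (simp add: field_simps)
    qed
    finally have le: "real (nn s i) \<le> Y s" .
    then have "real (nn s i) \<le> real N" using Y_upper[of s] by linarith
    then have "nn s i \<le> N" by simp
    then show "nn s i \<in> E"
      using nn(2)[OF s, of i] le ru rv by (simp add: E_def admissible_def lev)
  qed
  have inj: "inj_on (\<lambda>(s, i). nn s i) (Sigma {..<P} (\<lambda>s. {..<k s}))"
  proof (rule inj_onI)
    fix a b
    assume a: "a \<in> Sigma {..<P} (\<lambda>s. {..<k s})" and b: "b \<in> Sigma {..<P} (\<lambda>s. {..<k s})"
      and ab: "(\<lambda>(s, i). nn s i) a = (\<lambda>(s, i). nn s i) b"
    obtain s i s' i' where si: "a = (s, i)" "b = (s', i')" by (cases a, cases b)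
    have s: "s < P" "s' < P" and eq: "nn s i = nn s' i'"
      using a b ab si by auto
    have e: "16 * p * int i - int s = 16 * p * int i' - int s'"
      using eq nn(1)[of s i] nn(1)[of s' i'] s by (simp add: algebra_simps)
    have sp: "int s < p" "int s' < p" using s by (auto simp: p_def)
    have "i = i'"
    proof (rule ccontr)
      assume "i \<noteq> i'"
      then consider "int i + 1 \<le> int i'" | "int i' + 1 \<le> int i" by linarith
      then show False
      proof cases
        case 1
        then have "16 * p * (int i + 1) \<le> 16 * p * int i'" using p by (intro mult_left_mono) auto
        then show False using e sp p by (simp add: algebra_simps)
      next
        case 2
        then have "16 * p * (int i' + 1) \<le> 16 * p * int i" using p by (intro mult_left_mono) auto
        then show False using e sp p by (simp add: algebra_simps)
      qed
    qed
    then show "a = b" using e si by simp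
  qed
  have "1 / 32 = (\<Sum>s<P. 1 / (32 * real P))"
    using \<open>0 < P\<close> by simp
  also have "\<dots> \<le> (\<Sum>s<P. real (k s) * (1 / Y s))"
  proof (rule sum_mono)
    fix s
    define x where "x = Y s / (16 * real P)"
    have "4 \<le> x" using Y_lower[of s] \<open>0 < P\<close> by (simp add: x_def field_simps)
    then have "x / 2 \<le> real (k s)" unfolding k_def x_def[symmetric] by linarith
    moreover have "0 < Y s" using Y_lower[of s] \<open>0 < P\<close> by (smt (verit) of_nat_0_less_iff)
    ultimately have "x / 2 * (1 / Y s) \<le> real (k s) * (1 / Y s)"
      by (intro mult_right_mono) auto
    moreover have "x / 2 * (1 / Y s) = 1 / (32 * real P)"
      using \<open>0 < Y s\<close> by (simp add: x_def)
    ultimately show "1 / (32 * real P) \<le> real (k s) * (1 / Y s)" by simp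
  qed
  also have "\<dots> = (\<Sum>(s, i)\<in>Sigma {..<P} (\<lambda>s. {..<k s}). 1 / Y s)"
    by (subst sum.Sigma[symmetric]) auto
  also have "\<dots> = (\<Sum>(s, i)\<in>Sigma {..<P} (\<lambda>s. {..<k s}). 1 / level Q h' t (nn s i))"
    by (rule sum.cong) (auto simp: level)
  also have "\<dots> = (\<Sum>n\<in>(\<lambda>(s, i). nn s i) ` Sigma {..<P} (\<lambda>s. {..<k s}). 1 / level Q h' t n)"
    by (subst sum.reindex[OF inj]) (simp add: case_prod_beta)
  also have "\<dots> \<le> (\<Sum>n\<in>E. 1 / level Q h' t n)"
  proof (rule sum_mono2)
    show "finite E" by (simp add: E_def)
    show "(\<lambda>(s, i). nn s i) ` Sigma {..<P} (\<lambda>s. {..<k s}) \<subseteq> E"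
      using member by auto
    fix n show "0 \<le> 1 / level Q h' t n"
      using hpos by (intro divide_nonneg_nonneg level_nonneg) (auto simp: h'_def less_imp_le)
  qed
  finally show ?thesis .
qed

text \<open>
  A point \<open>t\<close> that is at least \<open>2 * Q * V\<close> beyond the beginning of its window keeps all its old
  terms, because they only involve positions in the same window. The new terms come from pairs of
  positions of which exactly one is raised, so no term is counted twice.
\<close>

lemma hit_mass_step:
  fixes h h' :: "int \<Rightarrow> real" and P Q R V N :: nat and t :: int
  assumes "0 < P"
    and per: "\<And>t. h (t + int P) = h t"
    and bd: "\<And>t. 1 \<le> h t" "\<And>t. h t \<le> real V"
    and R: "64 * P * V \<le> Q * R"
    and t: "2 * int (Q * V) \<le> t mod (4 * int P)"
  defines "h' \<equiv> \<lambda>t. h t * (if raised P t then real R else 1)"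
  shows "hit_mass (Q * V) Q h t + 1 / 32 \<le> hit_mass (Q * (V * R)) Q h' t"
proof -
  have "1 \<le> V" using bd[of 0] by linarith
  have "0 < R" using R \<open>0 < P\<close> \<open>1 \<le> V\<close> by (intro gr0I) auto
  have hpos: "0 < h x" for x using bd(1)[of x] by linarith
  define A where "A = admissible (Q * V) Q h t"
  define A' where "A' = admissible (Q * (V * R)) Q h' t"
  define E where "E = {n \<in> A'. raised P (t - int n) \<and> \<not> raised P (t - 2 * int n)}"
  have same: "raised P (t - int n) = raised P t" "raised P (t - 2 * int n) = raised P t"
    "level Q h' t n = level Q h t n" if "n \<le> Q * V" for n
  proof -
    have "int n \<le> int (Q * V)" using that by (simp only: of_nat_le_iff)
    then show r: "raised P (t - int n) = raised P t" "raised P (t - 2 * int n) = raised P t"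
      using t \<open>0 < P\<close> raised_same_window[of P "int n" t] raised_same_window[of P "2 * int n" t]
      by linarith+
    show "level Q h' t n = level Q h t n"
      using r \<open>0 < R\<close> by (simp add: level_def h'_def)
  qed
  have "Q * V \<le> Q * (V * R)" using \<open>0 < R\<close> by simp
  then have "A \<subseteq> A'"
    unfolding A_def A'_def admissible_def using same(3) le_trans[OF _ \<open>Q * V \<le> Q * (V * R)\<close>] by auto
  moreover have "A \<inter> E = {}"
    using same by (auto simp: A_def E_def admissible_def)
  moreover have "E \<subseteq> A'" by (auto simp: E_def)
  moreover have fin: "finite A" "finite A'" by (auto simp: A_def A'_def)
  moreover have nonneg: "0 \<le> 1 / level Q h' t n" for n
      using hpos by (intro divide_nonneg_nonneg level_nonneg) (auto simp: h'_def less_imp_le)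
  ultimately have "(\<Sum>n\<in>A. 1 / level Q h' t n) + (\<Sum>n\<in>E. 1 / level Q h' t n)
      \<le> (\<Sum>n\<in>A'. 1 / level Q h' t n)"
    by (subst sum.union_disjoint[symmetric]) (auto intro!: sum_mono2 intro: finite_subset)
  moreover have "(\<Sum>n\<in>A. 1 / level Q h' t n) = hit_mass (Q * V) Q h t"
    using same(3) by (auto simp: hit_mass_def A_def admissible_def intro!: sum.cong)
  moreover have "1 / 32 \<le> (\<Sum>n\<in>E. 1 / level Q h' t n)"
    unfolding E_def A'_def h'_def
    by (rule hit_mass_new_scale[where h = h and V = V, OF assms(1) per bd R]) (simp add: mult.assoc)
  ultimately show ?thesis
    by (simp add: hit_mass_def A'_def)
qed

text \<open>
  The period is proportional to \<open>Q\<close>, and the constants do not depend on \<open>Q\<close>. This uniformity allows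
  \<open>Q\<close> to be chosen after the bound \<open>V\<close> of \<open>h\<close>, which is needed to have \<open>\<delta> * h v / Q \<le> 1\<close>. Bad points
  are counted over every multiple of the period, so that the next step may start from a longer
  period. They stay below one half: the proportions \<open>1 / 2 ^ (l + 2)\<close> added by the steps have the sum \<open>1 / 2\<close>.
\<close>

lemma multiscale_heights:
  "\<exists>V C. 1 \<le> V \<and> 1 \<le> C \<and> (\<forall>Q\<ge>1. \<exists>h. (\<forall>t. h (t + int (C * Q)) = h t)
     \<and> (\<forall>t. 1 \<le> h t \<and> h t \<le> real V)
     \<and> (\<forall>M. card {t \<in> {0..<int (M * (C * Q))}. hit_mass (Q * V) Q h t < real l / 32}
          \<le> (1 / 2 - 1 / 2 ^ Suc l) * real (M * (C * Q))))"
proof (induction l)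
  case 0
  have nonneg: "\<not> hit_mass (Q * 1) Q (\<lambda>_. 1) t < 0" for Q t
    by (auto simp: hit_mass_def level_def not_less intro!: sum_nonneg)
  show ?case
  proof (intro exI[of _ 1] conjI allI impI exI[of _ "\<lambda>_. 1"])
    fix Q M :: nat
    show "real (card {t \<in> {0..<int (M * (1 * Q))}. hit_mass (Q * 1) Q (\<lambda>_. 1) t < real 0 / 32})
      \<le> (1 / 2 - 1 / 2 ^ Suc 0) * real (M * (1 * Q))"
      using nonneg by simp
  qed auto
next
  case (Suc l)
  then obtain V C where VC: "1 \<le> V" "1 \<le> C" and
    IH: "\<And>Q. 1 \<le> Q \<Longrightarrow> \<exists>h. (\<forall>t. h (t + int (C * Q)) = h t)
     \<and> (\<forall>t. 1 \<le> h t \<and> h t \<le> real V)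
     \<and> (\<forall>M. card {t \<in> {0..<int (M * (C * Q))}. hit_mass (Q * V) Q h t < real l / 32}
          \<le> (1 / 2 - 1 / 2 ^ Suc l) * real (M * (C * Q)))"
    by blast
  \<comment> \<open>\<open>k\<close> makes the windows so long that few \<open>t\<close> lie near a boundary; then \<open>R\<close> makes all new levels
     exceed the length of several windows.\<close>
  define k where "k = V * 2 ^ Suc l"
  define R where "R = 64 * k * C * V"
  have k: "0 < k" using VC by (simp add: k_def)
  then have R1: "1 \<le> R" using VC by (simp add: R_def Suc_le_eq)
  show ?case
  proof (rule exI[of _ "V * R"], rule exI[of _ "16 * k * C"], intro conjI allI impI)
    show "1 \<le> V * R" "1 \<le> 16 * k * C" using VC R1 k by (auto simp: Suc_le_eq)
    fix Q :: nat assume Q: "1 \<le> Q"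
    from IH[OF Q] obtain h where per: "\<And>t. h (t + int (C * Q)) = h t"
      and bd: "\<And>t. 1 \<le> h t" "\<And>t. h t \<le> real V"
      and bad: "\<And>M. card {t \<in> {0..<int (M * (C * Q))}. hit_mass (Q * V) Q h t < real l / 32}
          \<le> (1 / 2 - 1 / 2 ^ Suc l) * real (M * (C * Q))"
      by blast
    define P where "P = k * C * Q"
    have P: "0 < P" using k VC Q by (simp add: P_def)
    have P16: "16 * k * C * Q = 16 * P" by (simp add: P_def mult.assoc)
    have perP: "h (t + int P) = h t" for t
      using periodic_add_multiple[of h "int (C * Q)" t "int k"] per by (simp add: P_def mult.assoc)
    have RP: "64 * P * V \<le> Q * R" by (simp add: P_def R_def)
    define h' where "h' = (\<lambda>t. h t * (if raised P t then real R else 1))"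
    show "\<exists>h. (\<forall>t. h (t + int (16 * k * C * Q)) = h t)
     \<and> (\<forall>t. 1 \<le> h t \<and> h t \<le> real (V * R))
     \<and> (\<forall>M. card {t \<in> {0..<int (M * (16 * k * C * Q))}. hit_mass (Q * (V * R)) Q h t < real (Suc l) / 32}
          \<le> (1 / 2 - 1 / 2 ^ Suc (Suc l)) * real (M * (16 * k * C * Q)))"
      unfolding P16
    proof (intro exI[of _ h'] conjI allI)
      fix t
      show "h' (t + int (16 * P)) = h' t"
        using periodic_add_multiple[of h "int P" t 16] perP raised_periodic[OF P, of t]
        by (simp add: h'_def)
      show "1 \<le> h' t"
        using mult_mono[of 1 "h t" 1 "real R"] bd(1)[of t] R1 by (simp add: h'_def)
      show "h' t \<le> real (V * R)"
        using mult_mono[of "h t" "real V" "if raised P t then real R else 1" "real R"]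
          bd[of t] R1 by (simp add: h'_def split: if_splits)
    next
      fix M :: nat
      let ?B = "{t \<in> {0..<int (M * (16 * P))}. hit_mass (Q * (V * R)) Q h' t < real (Suc l) / 32}"
      let ?B1 = "{t \<in> {0..<int ((M * 16 * k) * (C * Q))}. hit_mass (Q * V) Q h t < real l / 32}"
      let ?B2 = "{t \<in> {0..<int ((M * 4) * (4 * P))}. t mod int (4 * P) < int (2 * (Q * V))}"
      have e1: "M * (16 * P) = (M * 16 * k) * (C * Q)" by (simp add: P_def)
      have e2: "M * (16 * P) = (M * 4) * (4 * P)" by simp
      have fin: "finite {t \<in> {0..<K}. p t}" for K :: int and p
        by (rule finite_subset[of _ "{0..<K}"]) auto
      have "?B \<subseteq> ?B1 \<union> ?B2"
      proof
        fix t assume t: "t \<in> ?B"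
        show "t \<in> ?B1 \<union> ?B2"
        proof (cases "2 * int (Q * V) \<le> t mod (4 * int P)")
          case True
          then have "hit_mass (Q * V) Q h t + 1 / 32 \<le> hit_mass (Q * (V * R)) Q h' t"
            unfolding h'_def using P by (intro hit_mass_step perP bd RP) auto
          then have "hit_mass (Q * V) Q h t < real l / 32" using t by (simp add: add_divide_distrib)
          then show ?thesis using t unfolding e1 by simp
        next
          case False
          then show ?thesis using t unfolding e2 by simp
        qed
      qed
      then have "card ?B \<le> card (?B1 \<union> ?B2)" by (intro card_mono finite_UnI fin)
      also have "\<dots> \<le> card ?B1 + card ?B2" by (rule card_Un_le)
      finally have "real (card ?B) \<le> real (card ?B1) + real (card ?B2)" by linarith
      also have "\<dots> \<le> (1 / 2 - 1 / 2 ^ Suc l) * real (M * (16 * P)) + real (M * 4 * (2 * (Q * V)))"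
      proof (rule add_mono)
        show "real (card ?B1) \<le> (1 / 2 - 1 / 2 ^ Suc l) * real (M * (16 * P))"
          unfolding e1 by (rule bad)
        show "real (card ?B2) \<le> real (M * 4 * (2 * (Q * V)))"
          using card_residues_below[of "4 * P" "M * 4" "2 * (Q * V)"] P by (simp only: of_nat_le_iff)
      qed
      also have "\<dots> \<le> (1 / 2 - 1 / 2 ^ Suc (Suc l)) * real (M * (16 * P))"
      proof -
        have "real (M * 4 * (2 * (Q * V))) * 1 \<le> real (M * 4 * (2 * (Q * V))) * real C"
          using VC by (intro mult_left_mono) auto
        also have "\<dots> = (1 / 2 ^ Suc (Suc l)) * real (M * (16 * P))"
          by (simp add: P_def k_def)
        finally show ?thesis by (simp add: algebra_simps)
      qed
      finally show "real (card ?B) \<le> (1 / 2 - 1 / 2 ^ Suc (Suc l)) * real (M * (16 * P))" .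
    qed
  qed
qed

section \<open>Periodic patterns on the integers\<close>

lemma inj_on_mod_multiples:
  fixes t c :: int
  assumes "0 < c" "c * int N < P"
  shows "inj_on (\<lambda>n. (t - c * int n) mod P) {1..N}"
proof (rule inj_onI)
  fix m n assume mn: "m \<in> {1..N}" "n \<in> {1..N}"
    and eq: "(t - c * int m) mod P = (t - c * int n) mod P"
  have dvd: "P dvd c * (int n - int m)"
    using eq by (simp add: mod_eq_dvd_iff algebra_simps)
  have "\<bar>int n - int m\<bar> \<le> int N" using mn by auto
  then have "\<bar>c * (int n - int m)\<bar> \<le> c * int N"
    using assms(1) by (simp add: abs_mult)
  then have "\<bar>c * (int n - int m)\<bar> < P" using assms(2) by linarith
  then have "c * (int n - int m) = 0"
    using dvd by (meson dvd_imp_le_int not_le abs_ge_self order_less_le_trans)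
  then show "m = n" using assms(1) by simp
qed

lemma sum_int_interval: "(\<Sum>t\<in>{0..<int P}. F t) = (\<Sum>p<P. F (int p))"
proof -
  have "{0..<int P} = int ` {..<P}"
    using image_int_atLeastLessThan[of 0 P] by (simp add: lessThan_atLeast0)
  then show ?thesis by (simp add: sum.reindex)
qed

text \<open>
  The random choice described at the top, with \<open>\<xi>\<close> and \<open>\<zeta>\<close> indexed by the residues modulo \<open>P\<close>.
  A period \<open>P > 2 * N\<close> makes the residues of \<open>t - n\<close>, and those of \<open>t - 2 * n\<close>, distinct for
  \<open>n \<le> N\<close>, which is the independence that the argument requires. The weights \<open>w\<close> and \<open>w'\<close> are
  scaled so that each of the three parts of \<open>\<Phi>\<close> has expectation at most \<open>P / 8\<close>: at most \<open>3 * P / 8\<close>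
  of the at least \<open>P / 2\<close> good points are missed.
\<close>

lemma periodic_pattern:
  fixes \<epsilon> :: real
  assumes "0 < \<epsilon>"
  shows "\<exists>(P::nat) (N::nat) (F :: int \<Rightarrow> real) (G :: int \<Rightarrow> real). 0 < P
     \<and> (\<forall>t. 0 \<le> F t \<and> 0 \<le> G t \<and> F (t + int P) = F t \<and> G (t + int P) = G t)
     \<and> (\<Sum>t\<in>{0..<int P}. F t) \<le> \<epsilon> * real P
     \<and> (\<Sum>t\<in>{0..<int P}. G t) \<le> \<epsilon> * real P
     \<and> real P / 8 \<le> card {t \<in> {0..<int P}. \<exists>n\<in>{1..N}. real n \<le> F (t - int n) * G (t - 2 * int n)}"
proof -
  define \<delta> where "\<delta> = min 1 (\<epsilon> / 3)"
  have \<delta>: "0 < \<delta>" "\<delta> \<le> 1" "3 * \<delta> \<le> \<epsilon>" using assms by (auto simp: \<delta>_def)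
  obtain l :: nat where l: "32 * 7 / \<delta>\<^sup>2 \<le> real l" using real_arch_simple by blast
  from multiscale_heights[of l] obtain V C where VC: "1 \<le> V" "1 \<le> C"
    and ex: "\<forall>Q\<ge>1. \<exists>h. (\<forall>t. h (t + int (C * Q)) = h t)
     \<and> (\<forall>t. 1 \<le> h t \<and> h t \<le> real V)
     \<and> (\<forall>M. card {t \<in> {0..<int (M * (C * Q))}. hit_mass (Q * V) Q h t < real l / 32}
          \<le> (1 / 2 - 1 / 2 ^ Suc l) * real (M * (C * Q)))"
    by blast
  \<comment> \<open>Then \<open>\<delta> * h v / Q\<close> is a probability.\<close>
  define Q where "Q = V"
  have Q: "1 \<le> Q" "real V \<le> real Q" using VC by (auto simp: Q_def)
  obtain h where per0: "\<And>t. h (t + int (C * Q)) = h t"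
      and bd: "\<And>t. 1 \<le> h t" "\<And>t. h t \<le> real V"
      and bad: "\<And>M. card {t \<in> {0..<int (M * (C * Q))}. hit_mass (Q * V) Q h t < real l / 32}
          \<le> (1 / 2 - 1 / 2 ^ Suc l) * real (M * (C * Q))"
    using ex Q(1) by blast
  define N where "N = Q * V"
  define P where "P = (2 * V + 1) * (C * Q)"
  have P: "0 < P" using VC Q by (simp add: P_def)
  have NP: "2 * int N < int P"
  proof -
    have "2 * N < (2 * V + 1) * (1 * Q)" using Q by (simp add: N_def algebra_simps)
    also have "\<dots> \<le> P" unfolding P_def using VC by (intro mult_le_mono) auto
    finally show ?thesis by linarith
  qed
  have per: "h (t + z * int P) = h t" for t z
    using periodic_add_multiple[of h "int (C * Q)" t "z * (2 * int V + 1)"] per0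
    by (simp add: P_def algebra_simps)
  have hmod: "h (t mod int P) = h t" for t
    using per[of "t mod int P" "t div int P"] by (simp add: mult.commute)
  have hpos: "0 < h t" for t using bd(1)[of t] by linarith
  define I where "I = {0..<int P}"
  have I: "finite I" "card I = P" by (auto simp: I_def)
  define S where "S = {t \<in> I. real l / 32 \<le> hit_mass N Q h t}"
  define p where "p = (\<lambda>u. \<delta> / h u)"
  define q where "q = (\<lambda>v. \<delta> * h v / real Q)"
  define w where "w = (\<lambda>u. h u / (8 * \<delta>))"
  define w' where "w' = (\<lambda>v. (real Q / h v) / (8 * \<delta>))"
  define D where "D = admissible N Q h"
  define a where "a = (\<lambda>t n. (t - int n) mod int P)"
  define b where "b = (\<lambda>t n. (t - 2 * int n) mod int P)"
  define \<Phi> where "\<Phi> = (\<lambda>\<xi> \<zeta>. (\<Sum>t\<in>S. \<Prod>n\<in>D t. 1 - \<xi> (a t n) * \<zeta> (b t n))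
             + (\<Sum>i\<in>I. w i * \<xi> i) + (\<Sum>i\<in>I. w' i * \<zeta> i))"
  have p01: "0 \<le> p i \<and> p i \<le> 1" for i
    using bd(1)[of i] hpos[of i] \<delta> by (simp add: p_def)
  have q01: "0 \<le> q i \<and> q i \<le> 1" for i
  proof -
    have "\<delta> * h i \<le> 1 * real Q" using \<delta> bd(2)[of i] hpos[of i] Q by (intro mult_mono) auto
    then show ?thesis using \<delta> hpos[of i] Q by (simp add: q_def)
  qed
  have D: "finite (D t)" "D t \<subseteq> {1..N}" for t by (auto simp: D_def admissible_def)
  have inj_a: "inj_on (a t) (D t)" for t
    using inj_on_subset[OF inj_on_mod_multiples[of 1 N "int P" t] D(2)] NP by (simp add: a_def)
  have inj_b: "inj_on (b t) (D t)" for t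
    using inj_on_subset[OF inj_on_mod_multiples[of 2 N "int P" t] D(2)] NP by (simp add: b_def)
  have abI: "a t n \<in> I" "b t n \<in> I" for t n using P by (auto simp: a_def b_def I_def)
  have "\<exists>\<xi> \<zeta>. (\<forall>i\<in>I. \<xi> i = 0 \<or> \<xi> i = 1) \<and> (\<forall>i\<in>I. \<zeta> i = 0 \<or> \<zeta> i = 1) \<and> \<Phi> \<xi> \<zeta> \<le> \<Phi> p q"
    unfolding \<Phi>_def by (rule sparse_selection[OF I(1) D(1) inj_a inj_b p01 q01])
  then obtain \<xi> \<zeta> where \<xi>: "\<And>i. i \<in> I \<Longrightarrow> \<xi> i = 0 \<or> \<xi> i = 1"
    and \<zeta>: "\<And>i. i \<in> I \<Longrightarrow> \<zeta> i = 0 \<or> \<zeta> i = 1" and le: "\<Phi> \<xi> \<zeta> \<le> \<Phi> p q"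
    by blast
  have pq: "p (a t n) * q (b t n) = \<delta>\<^sup>2 * (1 / level Q h t n)" for t n
    by (simp add: p_def q_def a_def b_def hmod level_def power2_eq_square mult_ac)
  have miss: "(\<Prod>n\<in>D t. 1 - p (a t n) * q (b t n)) \<le> 1 / 8" if "t \<in> S" for t
  proof -
    have "(\<Prod>n\<in>D t. 1 - p (a t n) * q (b t n)) \<le> (\<Prod>n\<in>D t. exp (- (\<delta>\<^sup>2 * (1 / level Q h t n))))"
    proof (rule prod_mono)
      fix n assume "n \<in> D t"
      have "p (a t n) * q (b t n) \<le> 1" using p01 q01 by (intro mult_le_one) auto
      moreover have "1 + - (\<delta>\<^sup>2 * (1 / level Q h t n)) \<le> exp (- (\<delta>\<^sup>2 * (1 / level Q h t n)))"
        by (rule exp_ge_add_one_self)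
      ultimately show "0 \<le> 1 - p (a t n) * q (b t n)
          \<and> 1 - p (a t n) * q (b t n) \<le> exp (- (\<delta>\<^sup>2 * (1 / level Q h t n)))"
        unfolding pq by linarith
    qed
    also have "\<dots> = exp (- (\<delta>\<^sup>2 * hit_mass N Q h t))"
      by (simp add: exp_sum[symmetric] D(1) hit_mass_def D_def sum_negf sum_distrib_left)
    also have "\<dots> \<le> 1 / 8"
    proof -
      have "7 \<le> \<delta>\<^sup>2 * (real l / 32)" using l \<delta>(1) by (simp add: field_simps)
      also have "\<dots> \<le> \<delta>\<^sup>2 * hit_mass N Q h t" using that by (intro mult_left_mono) (auto simp: S_def)
      finally have "8 \<le> exp (\<delta>\<^sup>2 * hit_mass N Q h t)"
        using exp_ge_add_one_self[of "\<delta>\<^sup>2 * hit_mass N Q h t"] by linarith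
      then show ?thesis by (simp add: exp_minus field_simps)
    qed
    finally show ?thesis .
  qed
  have S: "finite S" "S \<subseteq> I" "card S \<le> P"
    using I card_mono[of I S] by (auto simp: S_def)
  have "\<Phi> p q \<le> 3 * real P / 8"
  proof -
    have "(\<Sum>t\<in>S. \<Prod>n\<in>D t. 1 - p (a t n) * q (b t n)) \<le> real (card S) * (1 / 8)"
      using miss by (rule sum_bounded_above)
    also have "\<dots> \<le> real P / 8" using S(3) by simp
    finally have "(\<Sum>t\<in>S. \<Prod>n\<in>D t. 1 - p (a t n) * q (b t n)) \<le> real P / 8" .
    moreover have "(\<Sum>i\<in>I. w i * p i) = real P / 8"
    proof -
      have "w i * p i = 1 / 8" for i using hpos[of i] \<delta> by (simp add: w_def p_def)
      then have "(\<Sum>i\<in>I. w i * p i) = (\<Sum>i\<in>I. 1 / 8)" by (simp only:)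
      then show ?thesis using I(2) by simp
    qed
    moreover have "(\<Sum>i\<in>I. w' i * q i) = real P / 8"
    proof -
      have "w' i * q i = 1 / 8" for i using hpos[of i] \<delta> Q by (simp add: w'_def q_def)
      then have "(\<Sum>i\<in>I. w' i * q i) = (\<Sum>i\<in>I. 1 / 8)" by (simp only:)
      then show ?thesis using I(2) by simp
    qed
    ultimately show ?thesis unfolding \<Phi>_def by linarith
  qed
  then have total: "\<Phi> \<xi> \<zeta> \<le> 3 * real P / 8" using le by linarith
  have term_nonneg: "0 \<le> (\<Prod>n\<in>D t. 1 - \<xi> (a t n) * \<zeta> (b t n))" for t
    using \<xi>[OF abI(1)] \<zeta>[OF abI(2)] by (intro prod_nonneg) (metis diff_ge_0_iff_ge mult_cancel_left2 mult_zero_left mult_zero_right order_refl zero_le_one)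
  have S_nonneg: "0 \<le> (\<Sum>t\<in>S. \<Prod>n\<in>D t. 1 - \<xi> (a t n) * \<zeta> (b t n))"
    by (intro sum_nonneg term_nonneg)
  have w_nonneg: "0 \<le> (\<Sum>i\<in>I. w i * \<xi> i)"
    using \<xi> hpos \<delta> by (intro sum_nonneg mult_nonneg_nonneg) (fastforce simp: w_def less_imp_le)+
  have w'_nonneg: "0 \<le> (\<Sum>i\<in>I. w' i * \<zeta> i)"
    using \<zeta> hpos \<delta> by (intro sum_nonneg mult_nonneg_nonneg) (fastforce simp: w'_def less_imp_le)+
  define F where "F = (\<lambda>t. h t * \<xi> (t mod int P))"
  define G where "G = (\<lambda>t. real Q / h t * \<zeta> (t mod int P))"
  define H where "H = {t \<in> I. \<exists>n\<in>{1..N}. real n \<le> F (t - int n) * G (t - 2 * int n)}"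
  have modI: "t mod int P \<in> I" for t using P by (simp add: I_def)
  have F0: "0 \<le> F t" for t using \<xi>[OF modI[of t]] hpos[of t] by (auto simp: F_def)
  have G0: "0 \<le> G t" for t using \<zeta>[OF modI[of t]] hpos[of t] by (auto simp: G_def)
  have "h (t + int P) = h t" for t using per[of t 1] by simp
  then have perFG: "F (t + int P) = F t" "G (t + int P) = G t" for t by (auto simp: F_def G_def)
  have sumF: "(\<Sum>t\<in>I. F t) \<le> \<epsilon> * real P"
  proof -
    have "(\<Sum>t\<in>I. F t) = (\<Sum>t\<in>I. 8 * \<delta> * (w t * \<xi> t))"
      using \<delta> by (intro sum.cong) (auto simp: F_def w_def I_def)
    also have "\<dots> = 8 * \<delta> * (\<Sum>t\<in>I. w t * \<xi> t)" by (simp add: sum_distrib_left)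
    also have "\<dots> \<le> 8 * \<delta> * (3 * real P / 8)"
      using total w'_nonneg S_nonneg \<delta>
      unfolding \<Phi>_def by (intro mult_left_mono) auto
    also have "\<dots> = (3 * \<delta>) * real P" by simp
    also have "\<dots> \<le> \<epsilon> * real P" using \<delta>(3) by (intro mult_right_mono) auto
    finally show ?thesis .
  qed
  have sumG: "(\<Sum>t\<in>I. G t) \<le> \<epsilon> * real P"
  proof -
    have "(\<Sum>t\<in>I. G t) = (\<Sum>t\<in>I. 8 * \<delta> * (w' t * \<zeta> t))"
      using \<delta> by (intro sum.cong) (auto simp: G_def w'_def I_def)
    also have "\<dots> = 8 * \<delta> * (\<Sum>t\<in>I. w' t * \<zeta> t)" by (simp add: sum_distrib_left)
    also have "\<dots> \<le> 8 * \<delta> * (3 * real P / 8)"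
      using total w_nonneg S_nonneg \<delta>
      unfolding \<Phi>_def by (intro mult_left_mono) auto
    also have "\<dots> = (3 * \<delta>) * real P" by simp
    also have "\<dots> \<le> \<epsilon> * real P" using \<delta>(3) by (intro mult_right_mono) auto
    finally show ?thesis .
  qed
  have unhit: "\<xi> (a t n) * \<zeta> (b t n) = 0" if "t \<in> S - H" "n \<in> D t" for t n
  proof (rule ccontr)
    assume "\<xi> (a t n) * \<zeta> (b t n) \<noteq> 0"
    then have "\<xi> (a t n) = 1" "\<zeta> (b t n) = 1"
      using \<xi>[OF abI(1), of t n] \<zeta>[OF abI(2), of t n] by auto
    then have "F (t - int n) * G (t - 2 * int n) = level Q h t n"
      by (simp add: F_def G_def a_def b_def level_def)
    moreover have "n \<in> {1..N}" "real n \<le> level Q h t n"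
      using that(2) by (auto simp: D_def admissible_def)
    ultimately have "\<exists>n\<in>{1..N}. real n \<le> F (t - int n) * G (t - 2 * int n)"
      by (intro bexI[of _ n]) auto
    then have "t \<in> H" using that(1) S(2) unfolding H_def by blast
    then show False using that by simp
  qed
  have "(\<Prod>n\<in>D t. 1 - \<xi> (a t n) * \<zeta> (b t n)) = 1" if "t \<in> S - H" for t
    using unhit[OF that] by (intro prod.neutral) simp
  then have "real (card (S - H)) = (\<Sum>t\<in>S - H. \<Prod>n\<in>D t. 1 - \<xi> (a t n) * \<zeta> (b t n))"
    by simp
  also have "\<dots> \<le> (\<Sum>t\<in>S. \<Prod>n\<in>D t. 1 - \<xi> (a t n) * \<zeta> (b t n))"
    using S term_nonneg by (intro sum_mono2) auto
  also have "\<dots> \<le> 3 * real P / 8"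
    using total w_nonneg w'_nonneg unfolding \<Phi>_def by linarith
  finally have SH: "real (card (S - H)) \<le> 3 * real P / 8" .
  have "real P / 2 \<le> real (card S)"
  proof -
    let ?B = "{t \<in> I. hit_mass N Q h t < real l / 32}"
    have "real (card ?B) \<le> (1 / 2 - 1 / 2 ^ Suc l) * real P"
      using bad[of "2 * V + 1"] by (simp add: I_def N_def P_def)
    also have "\<dots> \<le> 1 / 2 * real P" by (intro mult_right_mono) auto
    finally have "real (card ?B) \<le> real P / 2" by simp
    moreover have "I \<subseteq> S \<union> ?B" by (auto simp: S_def)
    then have "card I \<le> card S + card ?B"
      using I(1) card_mono[of "S \<union> ?B" I] card_Un_le[of S ?B] by (auto simp: S_def)
    ultimately show ?thesis using I(2) by linarith
  qed
  moreover have "card S \<le> card (S - H) + card H"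
  proof -
    have "finite H" using I by (simp add: H_def)
    then show ?thesis
      using card_mono[of "(S - H) \<union> H" S] card_Un_le[of "S - H" H] S(1) by auto
  qed
  ultimately have "real P / 8 \<le> real (card H)" using SH by linarith
  then have H: "real P / 8 \<le> card {t \<in> {0..<int P}. \<exists>n\<in>{1..N}. real n \<le> F (t - int n) * G (t - 2 * int n)}"
    unfolding H_def I_def .
  show ?thesis
    by (rule exI[of _ P], rule exI[of _ N], rule exI[of _ F], rule exI[of _ G],
        intro conjI allI P F0 G0 perFG sumF[unfolded I_def] sumG[unfolded I_def] H)
qed

section \<open>Finite measure spaces and measure preserving maps\<close>

text \<open>
  The events \<open>A n\<close> are contained in the decreasing tails \<open>U n\<close>, whose intersection is the limit
  superior.
\<close>

lemma (in finite_measure) measure_infinitely_often: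
  assumes [measurable]: "\<And>n::nat. A n \<in> sets M" and c: "\<And>n. c \<le> measure M (A n)"
  shows "c \<le> measure M {x \<in> space M. \<exists>\<^sub>\<infinity>n. x \<in> A n}"
proof -
  define U where "U = (\<lambda>m. \<Union>n\<in>{m..}. A n)"
  have U [measurable]: "U m \<in> sets M" for m unfolding U_def by measurable
  have "c \<le> measure M (U m)" for m
  proof -
    have "measure M (A m) \<le> measure M (U m)"
      by (intro finite_measure_mono U) (auto simp: U_def)
    then show ?thesis using c[of m] by linarith
  qed
  moreover have "(\<lambda>m. measure M (U m)) \<longlonglongrightarrow> measure M (\<Inter>m. U m)"
  proof (rule finite_Lim_measure_decseq)
    show "decseq U" unfolding U_def decseq_def by (intro allI impI UN_mono) auto
  qed auto
  ultimately have "c \<le> measure M (\<Inter>m. U m)"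
    by (intro LIMSEQ_le_const) auto
  also have "(\<Inter>m. U m) = {x \<in> space M. \<exists>\<^sub>\<infinity>n. x \<in> A n}"
    using sets.sets_into_space[OF assms(1)] by (fastforce simp: U_def INFM_nat_le)
  finally show ?thesis .
qed

lemma measure_preserving_funpow:
  assumes "measure_preserving M T"
  shows "measure_preserving M (T ^^ n)"
proof (induction n)
  case 0
  have "id -` A \<inter> space M = A" if "A \<in> sets M" for A
    using sets.sets_into_space[OF that] by auto
  then show ?case by (simp add: measure_preserving_def)
next
  case (Suc n)
  have T: "T \<in> measurable M M" "T ^^ n \<in> measurable M M"
    using assms Suc by (auto simp: measure_preserving_def)
  have "emeasure M ((T ^^ Suc n) -` A \<inter> space M) = emeasure M A" if A: "A \<in> sets M" for A
  proof -
    have "T -` A \<inter> space M \<in> sets M" using T(1) A by (rule measurable_sets)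
    have "(T ^^ Suc n) -` A \<inter> space M = (T ^^ n) -` (T -` A \<inter> space M) \<inter> space M"
      using measurable_space[OF T(2)] by auto
    then have "emeasure M ((T ^^ Suc n) -` A \<inter> space M)
        = emeasure M ((T ^^ n) -` (T -` A \<inter> space M) \<inter> space M)"
      by (simp only:)
    also have "\<dots> = emeasure M (T -` A \<inter> space M)"
      using Suc \<open>T -` A \<inter> space M \<in> sets M\<close> unfolding measure_preserving_def by blast
    also have "\<dots> = emeasure M A"
      using assms A unfolding measure_preserving_def by blast
    finally show ?thesis .
  qed
  then show ?case
    using measurable_comp[OF T(2,1)] by (auto simp: measure_preserving_def comp_def)
qed

text \<open>
  A set that is not an atom splits into two parts of positive measure, and the smaller one has at
  most half of the measure.
\<close>

lemma (in finite_measure) non_atomic_small_set: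
  assumes "non_atomic M" "0 < measure M (space M)" "0 < e"
  shows "\<exists>A\<in>sets M. 0 < measure M A \<and> measure M A < e"
proof -
  have half: "\<exists>B\<in>sets M. 0 < measure M B \<and> measure M B \<le> measure M A / 2"
    if A: "A \<in> sets M" "0 < measure M A" for A
  proof -
    have "\<not> atom_of M A" using assms(1) by (auto simp: non_atomic_def)
    then obtain B where B: "B \<in> sets M" "B \<subseteq> A"
      "emeasure M B < emeasure M A" "emeasure M B \<noteq> 0"
      using A by (auto simp: atom_of_def emeasure_eq_measure)
    then have "measure M B < measure M A" "0 < measure M B"
      by (auto simp: emeasure_eq_measure zero_less_measure_iff ennreal_less_iff)
    moreover have "measure M (A - B) = measure M A - measure M B"
      using A B by (intro finite_measure_Diff)
    ultimately have "0 < measure M (A - B)"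
      "measure M B \<le> measure M A / 2 \<or> measure M (A - B) \<le> measure M A / 2"
      by linarith+
    then show ?thesis
      using A(1) B(1) \<open>0 < measure M B\<close> by blast
  qed
  have "\<exists>A\<in>sets M. 0 < measure M A \<and> measure M A \<le> measure M (space M) / 2 ^ n" for n
  proof (induction n)
    case 0
    then show ?case using assms(2) by (intro bexI[of _ "space M"]) auto
  next
    case (Suc n)
    then obtain A where A: "A \<in> sets M" "0 < measure M A"
      "measure M A \<le> measure M (space M) / 2 ^ n" by blast
    from half[OF A(1,2)] obtain B where "B \<in> sets M" "0 < measure M B"
      "measure M B \<le> measure M A / 2" by blast
    then show ?case using A(3) by (intro bexI[of _ B]) auto
  qed
  moreover obtain n where "measure M (space M) / 2 ^ n < e"
  proof -
    obtain n where "measure M (space M) / e < 2 ^ n"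
      using real_arch_pow[of 2 "measure M (space M) / e"] by auto
    then have "measure M (space M) / 2 ^ n < e" using assms(3) by (simp add: field_simps)
    then show ?thesis by (rule that)
  qed
  ultimately show ?thesis by (meson order_le_less_trans)
qed

section \<open>Hitting times of an ergodic map\<close>

locale ergodic_system = finite_measure M for M :: "'a measure" +
  fixes T :: "'a \<Rightarrow> 'a"
  assumes ergodic: "ergodic M T"
begin

lemma preserving: "measure_preserving M (T ^^ n)"
  using ergodic by (auto simp: ergodic_def intro: measure_preserving_funpow)

lemma measurable_funpow [measurable]: "T ^^ n \<in> measurable M M"
  using preserving by (auto simp: measure_preserving_def)

lemma measure_vimage_funpow:
  "A \<in> sets M \<Longrightarrow> measure M ((T ^^ n) -` A \<inter> space M) = measure M A"
  using preserving[of n] by (auto simp: measure_preserving_def measure_def)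

lemma funpow_in_space: "x \<in> space M \<Longrightarrow> (T ^^ n) x \<in> space M"
  by (rule measurable_space[OF measurable_funpow])

text \<open>
  Infinitely many visits, instead of at least one, make the set strictly invariant, as the definition
  of ergodicity demands.
\<close>

definition recurrent :: "'a set \<Rightarrow> 'a set" where
  "recurrent A = {x \<in> space M. \<exists>\<^sub>\<infinity>k. (T ^^ k) x \<in> A}"

lemma recurrent_sets [measurable]:
  assumes [measurable]: "A \<in> sets M"
  shows "recurrent A \<in> sets M"
  unfolding recurrent_def INFM_nat_le by measurable

lemma recurrent_funpow_iff:
  assumes "x \<in> space M"
  shows "(T ^^ n) x \<in> recurrent A \<longleftrightarrow> x \<in> recurrent A"
proof -
  have "(\<exists>\<^sub>\<infinity>k. (T ^^ (k + n)) x \<in> A) \<longleftrightarrow> (\<exists>\<^sub>\<infinity>k. (T ^^ k) x \<in> A)"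
  proof -
    have "frequently (\<lambda>k. (T ^^ (k + n)) x \<in> A) sequentially
        \<longleftrightarrow> frequently (\<lambda>k. (T ^^ k) x \<in> A) sequentially"
      unfolding frequently_def using eventually_sequentially_seg[of "\<lambda>k. (T ^^ k) x \<notin> A" n] by simp
    then show ?thesis by (simp add: cofinite_eq_sequentially)
  qed
  then show ?thesis
    using assms funpow_in_space[OF assms, of n] by (simp add: recurrent_def funpow_add)
qed

text \<open>
  By ergodicity it is enough that the set is not null, and its measure is at least that of \<open>A\<close>,
  because it is the limit superior of the preimages of \<open>A\<close>.
\<close>

lemma recurrent_conull:
  assumes A: "A \<in> sets M" "0 < measure M A"
  shows "measure M (recurrent A) = measure M (space M)"
proof -
  have "measure M A \<le> measure M {x \<in> space M. \<exists>\<^sub>\<infinity>n. x \<in> (T ^^ n) -` A \<inter> space M}"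
    using A(1) by (intro measure_infinitely_often) (auto simp: measure_vimage_funpow)
  also have "{x \<in> space M. \<exists>\<^sub>\<infinity>n. x \<in> (T ^^ n) -` A \<inter> space M} = recurrent A"
    by (auto simp: recurrent_def)
  finally have "0 < measure M (recurrent A)" using A(2) by linarith
  moreover have "T -` recurrent A \<inter> space M = recurrent A"
    using recurrent_funpow_iff[of _ 1 A] by (auto simp: recurrent_def)
  ultimately have "emeasure M (space M - recurrent A) = 0"
    using ergodic recurrent_sets[OF A(1)] by (auto simp: ergodic_def emeasure_eq_measure)
  then have "measure M (space M - recurrent A) = 0" by (simp add: measure_def)
  then show ?thesis
    using finite_measure_compl[OF recurrent_sets[OF A(1)]] by simp
qed

definition hitting_time :: "'a set \<Rightarrow> 'a \<Rightarrow> nat" where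
  "hitting_time A x = (LEAST k. (T ^^ k) x \<in> A)"

lemma measurable_hitting_time [measurable]:
  assumes [measurable]: "A \<in> sets M"
  shows "hitting_time A \<in> measurable M (count_space UNIV)"
  unfolding hitting_time_def by measurable

lemma hitting_time_hits:
  assumes "x \<in> recurrent A"
  shows "(T ^^ hitting_time A x) x \<in> A"
proof -
  have "\<exists>k. (T ^^ k) x \<in> A" using assms by (auto simp: recurrent_def INFM_nat_le)
  then show ?thesis unfolding hitting_time_def by (rule LeastI_ex)
qed

lemma hitting_time_funpow:
  assumes "x \<in> recurrent A" "n \<le> hitting_time A x"
  shows "hitting_time A ((T ^^ n) x) = hitting_time A x - n"
proof (unfold hitting_time_def[of A "(T ^^ n) x"], rule Least_equality)
  have "(T ^^ (hitting_time A x - n)) ((T ^^ n) x) = (T ^^ (hitting_time A x - n + n)) x"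
    by (simp only: funpow_add comp_apply)
  then show "(T ^^ (hitting_time A x - n)) ((T ^^ n) x) \<in> A"
    using hitting_time_hits[OF assms(1)] assms(2) by simp
next
  fix k assume "(T ^^ k) ((T ^^ n) x) \<in> A"
  then have "(T ^^ (k + n)) x \<in> A" by (simp add: funpow_add)
  then have "hitting_time A x \<le> k + n" unfolding hitting_time_def by (rule Least_le)
  then show "hitting_time A x - n \<le> k" by simp
qed

text \<open>
  The phases play the role of the levels of a Rokhlin tower of height \<open>P\<close>: as long as \<open>A\<close> is not
  reached, \<open>T\<close> lowers the hitting time by one and so moves a point from one phase to the preceding
  one.
\<close>

definition phase :: "'a set \<Rightarrow> nat \<Rightarrow> nat \<Rightarrow> 'a set" where
  "phase A P p = {x \<in> recurrent A. hitting_time A x mod P = p}"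

lemma phase_sets [measurable]:
  assumes [measurable]: "A \<in> sets M"
  shows "phase A P p \<in> sets M"
proof -
  have "phase A P p = {x \<in> space M. x \<in> recurrent A \<and> hitting_time A x mod P = p}"
    by (auto simp: phase_def recurrent_def)
  also have "\<dots> \<in> sets M" by measurable
  finally show ?thesis .
qed

text \<open>
  The preimage of phase \<open>p\<close> is phase \<open>p + 1\<close>, up to points of \<open>A\<close>.
\<close>

lemma phase_measure_step:
  assumes A: "A \<in> sets M" and p: "Suc p < P"
  shows "measure M (phase A P (Suc p)) \<le> measure M (phase A P p)"
    and "measure M (phase A P p) \<le> measure M (phase A P (Suc p)) + measure M A"
proof -
  let ?pre = "(T ^^ 1) -` phase A P p \<inter> space M"
  have pre: "measure M ?pre = measure M (phase A P p)" "?pre \<in> sets M"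
    by (rule measure_vimage_funpow[OF phase_sets[OF A]])
      (rule measurable_sets[OF measurable_funpow phase_sets[OF A]])
  have step: "hitting_time A (T x) + 1 = hitting_time A x" "T x \<in> recurrent A"
    if "x \<in> recurrent A" "0 < hitting_time A x" for x
    using that hitting_time_funpow[of x A 1] recurrent_funpow_iff[of x 1 A]
    by (auto simp: recurrent_def)
  have "phase A P (Suc p) \<subseteq> ?pre"
  proof
    fix x assume x: "x \<in> phase A P (Suc p)"
    then have xr: "x \<in> recurrent A" "hitting_time A x mod P = Suc p" by (auto simp: phase_def)
    then have "0 < hitting_time A x" by (intro gr0I) auto
    from step[OF xr(1) this] have "Suc (hitting_time A (T x)) mod P = Suc p" "T x \<in> recurrent A"
      using xr(2) by auto
    then have "T x \<in> phase A P p" by (auto simp: phase_def mod_Suc split: if_splits)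
    then show "x \<in> ?pre" using xr(1) by (auto simp: recurrent_def)
  qed
  then show "measure M (phase A P (Suc p)) \<le> measure M (phase A P p)"
    unfolding pre(1)[symmetric] by (rule finite_measure_mono[OF _ pre(2)])
  have "?pre \<subseteq> phase A P (Suc p) \<union> A"
  proof
    fix x assume x: "x \<in> ?pre"
    then have xr: "x \<in> recurrent A" "hitting_time A (T x) mod P = p"
      using recurrent_funpow_iff[of x 1 A] by (auto simp: phase_def)
    show "x \<in> phase A P (Suc p) \<union> A"
    proof (cases "x \<in> A")
      case False
      then have "hitting_time A x \<noteq> 0" using hitting_time_hits[OF xr(1)] by (metis funpow_0)
      then have "hitting_time A x = Suc (hitting_time A (T x))" using step[OF xr(1)] by simp
      then show ?thesis using xr p by (simp add: phase_def mod_Suc)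
    qed simp
  qed
  then have "measure M ?pre \<le> measure M (phase A P (Suc p) \<union> A)"
    using A by (intro finite_measure_mono) auto
  also have "\<dots> \<le> measure M (phase A P (Suc p)) + measure M A"
    using A by (intro measure_Un_le) auto
  finally show "measure M (phase A P p) \<le> measure M (phase A P (Suc p)) + measure M A"
    using pre(1) by simp
qed

text \<open>
  Any two phases differ in measure by at most \<open>P * measure M A\<close>, and all of them together fill
  the space.
\<close>

lemma phase_measure_bounds:
  assumes A: "A \<in> sets M" "0 < measure M A" and "p < P"
  shows "\<bar>real P * measure M (phase A P p) - measure M (space M)\<bar> \<le> (real P)\<^sup>2 * measure M A"
proof -
  define a where "a = (\<lambda>p. measure M (phase A P p))"
  have chain: "a (p + k) \<le> a p \<and> a p \<le> a (p + k) + real k * measure M A" if "p + k < P" for p k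
    using that
  proof (induction k)
    case (Suc k)
    then show ?case
      using phase_measure_step[OF A(1), of "p + k" P] by (auto simp: a_def algebra_simps)
  qed simp
  have diff: "\<bar>a p - a q\<bar> \<le> real P * measure M A" if pq: "p < P" "q < P" for p q
  proof -
    have *: "\<bar>a p - a q\<bar> \<le> real P * measure M A" if "p \<le> q" "q < P" for p q
    proof -
      have "real (q - p) * measure M A \<le> real P * measure M A"
        using that by (intro mult_right_mono) auto
      then show ?thesis using chain[of p "q - p"] that by auto
    qed
    show ?thesis
    proof (cases "p \<le> q")
      case True
      then show ?thesis using *[of p q] pq by simp
    next
      case False
      then show ?thesis using *[of q p] pq by (simp add: abs_minus_commute)
    qed
  qed
  have "recurrent A = (\<Union>p<P. phase A P p)"
    using assms(3) by (auto simp: phase_def)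
  moreover have "measure M (\<Union>p<P. phase A P p) = (\<Sum>p<P. a p)"
    unfolding a_def
  proof (rule finite_measure_finite_Union)
    show "phase A P ` {..<P} \<subseteq> sets M" using phase_sets[OF A(1)] by blast
    show "disjoint_family_on (phase A P) {..<P}"
      by (auto simp: disjoint_family_on_def phase_def)
  qed simp
  ultimately have total: "(\<Sum>q<P. a q) = measure M (space M)"
    using recurrent_conull[OF A] by simp
  have "\<bar>real P * a p - (\<Sum>q<P. a q)\<bar> = \<bar>\<Sum>q<P. a p - a q\<bar>"
    by (simp add: sum_subtractf)
  also have "\<dots> \<le> (\<Sum>q<P. \<bar>a p - a q\<bar>)" by (rule sum_abs)
  also have "\<dots> \<le> real P * (real P * measure M A)"
    using diff assms(3) sum_bounded_above[of "{..<P}" "\<lambda>q. \<bar>a p - a q\<bar>" "real P * measure M A"] by simp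
  finally show ?thesis unfolding total by (simp add: a_def power2_eq_square mult.assoc)
qed

lemma hitting_time_less_measure:
  assumes A: "A \<in> sets M"
  shows "measure M {x \<in> recurrent A. hitting_time A x < m} \<le> real m * measure M A"
proof -
  have "{x \<in> recurrent A. hitting_time A x < m} \<subseteq> (\<Union>k<m. (T ^^ k) -` A \<inter> space M)"
  proof
    fix x assume x: "x \<in> {x \<in> recurrent A. hitting_time A x < m}"
    then have "x \<in> (T ^^ hitting_time A x) -` A \<inter> space M"
      using hitting_time_hits[of x A] by (auto simp: recurrent_def)
    then show "x \<in> (\<Union>k<m. (T ^^ k) -` A \<inter> space M)" using x by blast
  qed
  then have "measure M {x \<in> recurrent A. hitting_time A x < m}
      \<le> measure M (\<Union>k<m. (T ^^ k) -` A \<inter> space M)"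
    using A by (intro finite_measure_mono) auto
  also have "\<dots> \<le> (\<Sum>k<m. measure M ((T ^^ k) -` A \<inter> space M))"
    using A by (intro finite_measure_subadditive_finite) auto
  also have "\<dots> = real m * measure M A"
    using A by (simp add: measure_vimage_funpow)
  finally show ?thesis .
qed

section \<open>From patterns to functions on the space\<close>

text \<open>
  The value is \<open>F\<close> at the hitting time, so that \<open>F\<close> is read backwards along an orbit. The
  definition as a finite sum makes integrability and the integral immediate.
\<close>

definition orbit_copy :: "'a set \<Rightarrow> nat \<Rightarrow> (int \<Rightarrow> real) \<Rightarrow> 'a \<Rightarrow> real" where
  "orbit_copy A P F x = (\<Sum>p<P. F (int p) * indicator (phase A P p) x)"

lemma orbit_copy_eq:
  assumes "x \<in> recurrent A" "0 < P" and per: "\<And>t. F (t + int P) = F t"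
  shows "orbit_copy A P F x = F (int (hitting_time A x))"
proof -
  define p where "p = hitting_time A x mod P"
  have "orbit_copy A P F x = (\<Sum>q<P. if q = p then F (int q) else 0)"
    unfolding orbit_copy_def using assms(1)
    by (intro sum.cong) (auto simp: phase_def p_def indicator_def)
  also have "\<dots> = F (int p)" using assms(2) by (simp add: p_def)
  also have "\<dots> = F (int p + int (hitting_time A x div P) * int P)"
    using periodic_add_multiple[of F "int P"] per by metis
  also have "int p + int (hitting_time A x div P) * int P = int (hitting_time A x)"
    unfolding p_def by (metis mod_div_mult_eq of_nat_add of_nat_mult)
  finally show ?thesis .
qed

lemma orbit_copy_L1_plus:
  assumes [measurable]: "A \<in> sets M" and "\<And>t. 0 \<le> F t"
  shows "orbit_copy A P F \<in> L1_plus M"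
    and "integral\<^sup>L M (orbit_copy A P F) = (\<Sum>p<P. F (int p) * measure M (phase A P p))"
proof -
  have int: "integrable M (\<lambda>x. F (int p) * indicator (phase A P p) x)" for p
    by (intro integrable_mult_right integrable_real_indicator) (auto simp: emeasure_eq_measure)
  have "integrable M (orbit_copy A P F)"
    unfolding orbit_copy_def[abs_def] by (intro Bochner_Integration.integrable_sum int)
  then show "orbit_copy A P F \<in> L1_plus M"
    using assms(2) by (auto simp: L1_plus_def orbit_copy_def intro!: sum_nonneg simp del: sum_mult_indicator)
  have "integral\<^sup>L M (orbit_copy A P F) = (\<Sum>p<P. integral\<^sup>L M (\<lambda>x. F (int p) * indicator (phase A P p) x))"
    unfolding orbit_copy_def[abs_def] by (intro Bochner_Integration.integral_sum int)
  also have "\<dots> = (\<Sum>p<P. F (int p) * measure M (phase A P p))"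
    by (intro sum.cong refl) simp
  finally show "integral\<^sup>L M (orbit_copy A P F) = (\<Sum>p<P. F (int p) * measure M (phase A P p))" .
qed

text \<open>
  The set \<open>A\<close> is so small that every phase has measure comparable to \<open>1 / P\<close> of the space,
  and that few points reach \<open>A\<close> within \<open>2 * N\<close> steps. For all other points in the phase of a hit
  position, the orbit sees the pattern undisturbed.
\<close>

lemma pattern_transfer:
  fixes F G :: "int \<Rightarrow> real"
  defines "m \<equiv> measure M (space M)"
  assumes "non_atomic M" and m: "0 < m" and P: "0 < P"
    and nonneg: "\<And>t. 0 \<le> F t" "\<And>t. 0 \<le> G t"
    and per: "\<And>t. F (t + int P) = F t" "\<And>t. G (t + int P) = G t"
    and mean: "(\<Sum>t\<in>{0..<int P}. F t) \<le> \<epsilon> * real P" "(\<Sum>t\<in>{0..<int P}. G t) \<le> \<epsilon> * real P"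
    and hits: "real P / 8 \<le> card {t \<in> {0..<int P}. \<exists>n\<in>{1..N}. real n \<le> F (t - int n) * G (t - 2 * int n)}"
  shows "\<exists>f\<in>L1_plus M. \<exists>g\<in>L1_plus M. integral\<^sup>L M f \<le> 2 * \<epsilon> * m \<and> integral\<^sup>L M g \<le> 2 * \<epsilon> * m
     \<and> m / 32 \<le> measure M {x \<in> space M. \<exists>n\<ge>1. real n \<le> f ((T ^^ n) x) * g ((T ^^ (2 * n)) x)}"
proof -
  \<comment> \<open>The first part of the denominator keeps the phases even, the second one bounds the set of
     points that are within \<open>2 * N\<close> steps of \<open>A\<close>.\<close>
  define e where "e = m / (2 * (real P)\<^sup>2 + 64 * real N)"
  have denom: "0 < 2 * (real P)\<^sup>2 + 64 * real N" using P by (intro add_pos_nonneg) auto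
  obtain A where A: "A \<in> sets M" "0 < measure M A" "measure M A < e"
    using non_atomic_small_set[of e] assms(2) m denom by (auto simp: e_def m_def)
  have small: "measure M A * (2 * (real P)\<^sup>2 + 64 * real N) \<le> m"
    using A(3) denom by (simp add: e_def pos_less_divide_eq)
  define x where "x = (real P)\<^sup>2 * measure M A"
  define y where "y = real N * measure M A"
  have "0 \<le> x" "0 \<le> y" "2 * x + 64 * y \<le> m" "real (2 * N) * measure M A = 2 * y"
    using small by (simp_all add: x_def y_def algebra_simps)
  then have small1: "(real P)\<^sup>2 * measure M A \<le> m / 2"
    and small2: "real (2 * N) * measure M A \<le> m / 32"
    unfolding x_def[symmetric] by linarith+
  have phase: "measure M (phase A P p) \<le> 2 * m / real P" "m / (2 * real P) \<le> measure M (phase A P p)"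
    if "p < P" for p
    using phase_measure_bounds[OF A(1,2) that] small1 P m unfolding m_def[symmetric]
    by (auto simp: field_simps abs_le_iff)
  define f where "f = orbit_copy A P F"
  define g where "g = orbit_copy A P G"
  have f: "f \<in> L1_plus M" and g: "g \<in> L1_plus M"
    using A(1) nonneg by (auto simp: f_def g_def intro!: orbit_copy_L1_plus)
  have [measurable]: "f \<in> borel_measurable M" "g \<in> borel_measurable M"
    using f g by (auto simp: L1_plus_def)
  have bound: "integral\<^sup>L M (orbit_copy A P K) \<le> 2 * \<epsilon> * m"
    if K: "\<And>t. 0 \<le> K t" "(\<Sum>t\<in>{0..<int P}. K t) \<le> \<epsilon> * real P" for K
  proof -
    have "integral\<^sup>L M (orbit_copy A P K) \<le> (\<Sum>p<P. K (int p) * (2 * m / real P))"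
      unfolding orbit_copy_L1_plus(2)[OF A(1) K(1)]
      using K(1) phase(1) by (intro sum_mono mult_left_mono) auto
    also have "\<dots> = (\<Sum>t\<in>{0..<int P}. K t) * (2 * m / real P)"
      by (simp only: sum_int_interval sum_distrib_right)
    also have "\<dots> \<le> \<epsilon> * real P * (2 * m / real P)"
      using K(2) m by (intro mult_right_mono) auto
    also have "\<dots> = 2 * \<epsilon> * m" using P by simp
    finally show ?thesis .
  qed
  define H where "H = {p. p < P \<and> (\<exists>n\<in>{1..N}. real n \<le> F (int p - int n) * G (int p - 2 * int n))}"
  have H: "finite H" "H \<subseteq> {..<P}" by (auto simp: H_def)
  have "{t \<in> {0..<int P}. \<exists>n\<in>{1..N}. real n \<le> F (t - int n) * G (t - 2 * int n)} = int ` H"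
  proof (intro equalityI subsetI)
    fix t assume t: "t \<in> {t \<in> {0..<int P}. \<exists>n\<in>{1..N}. real n \<le> F (t - int n) * G (t - 2 * int n)}"
    then have "t = int (nat t)" "nat t < P" by auto
    then show "t \<in> int ` H" using t by (intro image_eqI[of _ _ "nat t"]) (auto simp: H_def)
  qed (auto simp: H_def)
  then have cardH: "real P / 8 \<le> real (card H)"
    using hits by (simp add: card_image)
  define R where "R = {x \<in> space M. \<exists>n\<ge>1. real n \<le> f ((T ^^ n) x) * g ((T ^^ (2 * n)) x)}"
  define S where "S = {x \<in> recurrent A. hitting_time A x < 2 * N}"
  have [measurable]: "R \<in> sets M" unfolding R_def by measurable
  have S_sets: "S \<in> sets M"
  proof -
    have "S = {x \<in> space M. x \<in> recurrent A \<and> hitting_time A x < 2 * N}"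
      by (auto simp: S_def recurrent_def)
    also have "\<dots> \<in> sets M" using A(1) by measurable
    finally show ?thesis .
  qed
  have "(\<Union>p\<in>H. phase A P p) \<subseteq> R \<union> S"
  proof
    fix x assume "x \<in> (\<Union>p\<in>H. phase A P p)"
    then obtain p where p: "p \<in> H" "x \<in> phase A P p" by blast
    then obtain n where n: "n \<in> {1..N}" "real n \<le> F (int p - int n) * G (int p - 2 * int n)"
      by (auto simp: H_def)
    have x: "x \<in> recurrent A" "hitting_time A x mod P = p" using p(2) by (auto simp: phase_def)
    have xs: "x \<in> space M" using x(1) by (simp add: recurrent_def)
    show "x \<in> R \<union> S"
    proof (cases "hitting_time A x < 2 * N")
      case True
      then show ?thesis using x(1) by (simp add: S_def)
    next
      case False
      have copy: "orbit_copy A P K ((T ^^ k) x) = K (int p - int k)"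
        if perK: "\<And>t. K (t + int P) = K t" and k: "k \<le> 2 * N" for K k
      proof -
        have le: "k \<le> hitting_time A x" using k False by simp
        have "orbit_copy A P K ((T ^^ k) x) = K (int (hitting_time A ((T ^^ k) x)))"
          using x(1) xs P perK by (intro orbit_copy_eq) (auto simp: recurrent_funpow_iff)
        also have "int (hitting_time A ((T ^^ k) x)) = int (hitting_time A x) - int k"
          using hitting_time_funpow[OF x(1) le] le by (simp add: of_nat_diff)
        also have "\<dots> = int p - int k + int (hitting_time A x div P) * int P"
        proof -
          have "int (hitting_time A x) = int p + int (hitting_time A x div P) * int P"
            using x(2) by (metis mod_div_mult_eq of_nat_add of_nat_mult)
          then show ?thesis by simp
        qed
        also have "K \<dots> = K (int p - int k)"
          using periodic_add_multiple[of K "int P"] perK by metis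
        finally show ?thesis .
      qed
      have "real n \<le> f ((T ^^ n) x) * g ((T ^^ (2 * n)) x)"
        using n copy[of F n] copy[of G "2 * n"] per by (simp add: f_def g_def)
      then show ?thesis using xs n(1) by (auto simp: R_def)
    qed
  qed
  then have "measure M (\<Union>p\<in>H. phase A P p) \<le> measure M (R \<union> S)"
    using S_sets by (intro finite_measure_mono) auto
  also have "\<dots> \<le> measure M R + measure M S"
    using S_sets by (intro measure_Un_le) auto
  also have "measure M S \<le> m / 32"
    using hitting_time_less_measure[OF A(1), of "2 * N"] small2 unfolding S_def by linarith
  finally have upper: "measure M (\<Union>p\<in>H. phase A P p) \<le> measure M R + m / 32" by simp
  have "m / 16 = real P / 8 * (m / (2 * real P))" using P by simp
  also have "\<dots> \<le> real (card H) * (m / (2 * real P))"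
    using cardH m by (intro mult_right_mono) auto
  also have "\<dots> = (\<Sum>p\<in>H. m / (2 * real P))" by simp
  also have "\<dots> \<le> (\<Sum>p\<in>H. measure M (phase A P p))"
    using phase(2) by (intro sum_mono) (auto simp: H_def)
  also have "\<dots> = measure M (\<Union>p\<in>H. phase A P p)"
  proof (rule finite_measure_finite_Union[symmetric])
    show "phase A P ` H \<subseteq> sets M" using phase_sets[OF A(1)] by blast
    show "disjoint_family_on (phase A P) H"
      by (auto simp: disjoint_family_on_def phase_def)
  qed (rule H)
  finally have "m / 32 \<le> measure M R" using upper by linarith
  then show ?thesis
    using f g bound[OF nonneg(1) mean(1)] bound[OF nonneg(2) mean(2)]
    unfolding R_def f_def g_def by blast
qed

lemma AE_funpow:
  assumes "AE x in M. Q x"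
  shows "AE x in M. Q ((T ^^ n) x)"
proof -
  obtain N where N: "{x \<in> space M. \<not> Q x} \<subseteq> N" "N \<in> sets M" "emeasure M N = 0"
    using assms by (auto elim: AE_E)
  have "(T ^^ n) -` N \<inter> space M \<in> null_sets M"
    using N(2,3) preserving[of n] measurable_sets[OF measurable_funpow N(2)]
    by (auto simp: measure_preserving_def)
  then show ?thesis
    by (rule AE_I') (use N(1) funpow_in_space in auto)
qed

text \<open>
  The sum of the series is finite only almost everywhere, so it is formed in \<open>[0, \<infinity>]\<close>; the value
  0 given by \<open>enn2real\<close> at \<open>\<infinity>\<close> affects a null set.
\<close>

lemma L1_plus_dominates_sequence:
  assumes u: "\<And>j. u j \<in> L1_plus M" and small: "\<And>j. integral\<^sup>L M (u j) \<le> (1 / 2) ^ j"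
  shows "\<exists>f\<in>L1_plus M. AE x in M. \<forall>j. u j x \<le> f x"
proof -
  have int: "integrable M (u j)" and nonneg: "\<And>x. x \<in> space M \<Longrightarrow> 0 \<le> u j x" for j
    using u by (auto simp: L1_plus_def)
  have [measurable]: "u j \<in> borel_measurable M" for j using int by auto
  define s where "s = (\<lambda>x. \<Sum>j. ennreal (u j x))"
  have [measurable]: "s \<in> borel_measurable M" unfolding s_def by measurable
  have "(\<integral>\<^sup>+x. s x \<partial>M) = (\<Sum>j. \<integral>\<^sup>+x. ennreal (u j x) \<partial>M)"
    unfolding s_def by (intro nn_integral_suminf) measurable
  also have "\<dots> = (\<Sum>j. ennreal (integral\<^sup>L M (u j)))"
    using int nonneg by (intro suminf_cong nn_integral_eq_integral) auto
  also have "\<dots> \<le> (\<Sum>j. ennreal ((1 / 2) ^ j))"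
    using small by (intro suminf_le ennreal_leI) auto
  also have "\<dots> = ennreal (\<Sum>j. (1 / 2) ^ j)"
    by (intro suminf_ennreal2) auto
  also have "\<dots> < \<infinity>" by simp
  finally have fin: "(\<integral>\<^sup>+x. s x \<partial>M) < \<infinity>" .
  then have AE_fin: "AE x in M. s x \<noteq> \<infinity>"
    by (intro nn_integral_PInf_AE) auto
  define f where "f = (\<lambda>x. enn2real (s x))"
  have [measurable]: "f \<in> borel_measurable M" unfolding f_def by measurable
  have "(\<integral>\<^sup>+x. ennreal (norm (f x)) \<partial>M) \<le> (\<integral>\<^sup>+x. s x \<partial>M)"
    by (intro nn_integral_mono) (auto simp: f_def ennreal_enn2real_if)
  then have "integrable M f"
    using fin by (intro integrableI_bounded) (auto simp: order_le_less_trans)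
  then have "f \<in> L1_plus M" by (auto simp: L1_plus_def f_def)
  moreover have "AE x in M. \<forall>j. u j x \<le> f x"
    using AE_fin
  proof (rule AE_mp, intro AE_I2 impI allI)
    fix x j assume x: "x \<in> space M" "s x \<noteq> \<infinity>"
    have "ennreal (u j x) = (\<Sum>i\<in>{j}. ennreal (u i x))" by simp
    also have "\<dots> \<le> s x" unfolding s_def by (rule sum_le_suminf) auto
    also have "s x = ennreal (f x)" using x(2) by (simp add: f_def top.not_eq_extremum)
    finally show "u j x \<le> f x" by (simp add: f_def)
  qed
  ultimately show ?thesis by blast
qed

end

section \<open>Divergence of the maximal function\<close>

theorem theorem2:
  fixes M :: "'a measure" and T :: "'a \<Rightarrow> 'a"
  assumes "finite_measure M"
    and "emeasure M (space M) > 0"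
    and "non_atomic M"
    and "ergodic M T"
  shows "\<exists>f\<in>L1_plus M. \<exists>g\<in>L1_plus M. \<not> (AE x in M. R_star T f g x < \<infinity>)"
proof -
  interpret finite_measure M by fact
  interpret ergodic_system M T by unfold_locales fact
  define m where "m = measure M (space M)"
  have m: "0 < m" using assms(2) by (simp add: m_def emeasure_eq_measure)
  define hit where "hit = (\<lambda>(j::nat) u v. {x \<in> space M. \<exists>n\<ge>1. real (Suc j) * real n \<le> u ((T ^^ n) x) * v ((T ^^ (2 * n)) x)})"
  have "\<exists>u\<in>L1_plus M. \<exists>v\<in>L1_plus M. integral\<^sup>L M u \<le> (1 / 2) ^ j \<and> integral\<^sup>L M v \<le> (1 / 2) ^ j
     \<and> m / 32 \<le> measure M (hit j u v)" for j
  proof -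
    define \<epsilon> where "\<epsilon> = (1 / 2) ^ j / (2 * m * real (Suc j))"
    have "0 < \<epsilon>" using m by (simp add: \<epsilon>_def)
    obtain P N F G where "0 < P"
      "\<forall>t. 0 \<le> F t \<and> 0 \<le> G t \<and> F (t + int P) = F t \<and> G (t + int P) = G t"
      "(\<Sum>t\<in>{0..<int P}. F t) \<le> \<epsilon> * real P" "(\<Sum>t\<in>{0..<int P}. G t) \<le> \<epsilon> * real P"
      "real P / 8 \<le> card {t \<in> {0..<int P}. \<exists>n\<in>{1..N}. real n \<le> F (t - int n) * G (t - 2 * int n)}"
      using periodic_pattern[OF \<open>0 < \<epsilon>\<close>] by blast
    then obtain f g where fg: "f \<in> L1_plus M" "g \<in> L1_plus M"
      and small: "integral\<^sup>L M f \<le> 2 * \<epsilon> * m" "integral\<^sup>L M g \<le> 2 * \<epsilon> * m"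
      and large: "m / 32 \<le> measure M {x \<in> space M. \<exists>n\<ge>1. real n \<le> f ((T ^^ n) x) * g ((T ^^ (2 * n)) x)}"
      using pattern_transfer[of P F G \<epsilon> N] assms(3) m unfolding m_def by blast
    have [measurable]: "f \<in> borel_measurable M" "g \<in> borel_measurable M"
      using fg by (auto simp: L1_plus_def)
    \<comment> \<open>Scaling both functions by \<open>j + 1\<close> turns hits at height \<open>n\<close> into hits at height \<open>(j + 1) * n\<close>;
       \<open>\<epsilon>\<close> compensates the factor in the integrals.\<close>
    define u where "u = (\<lambda>x. real (Suc j) * f x)"
    define v where "v = (\<lambda>x. real (Suc j) * g x)"
    have "u \<in> L1_plus M" "v \<in> L1_plus M"
      using fg by (auto simp: L1_plus_def u_def v_def)
    moreover have "integral\<^sup>L M u \<le> (1 / 2) ^ j" "integral\<^sup>L M v \<le> (1 / 2) ^ j"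
    proof -
      have "real (Suc j) * (2 * \<epsilon> * m) = (1 / 2) ^ j"
        using m by (simp add: \<epsilon>_def divide_simps)
      then show "integral\<^sup>L M u \<le> (1 / 2) ^ j" "integral\<^sup>L M v \<le> (1 / 2) ^ j"
        using mult_left_mono[OF small(1), of "real (Suc j)"] mult_left_mono[OF small(2), of "real (Suc j)"]
        by (simp_all add: u_def v_def)
    qed
    moreover have "m / 32 \<le> measure M (hit j u v)"
    proof -
      have "{x \<in> space M. \<exists>n\<ge>1. real n \<le> f ((T ^^ n) x) * g ((T ^^ (2 * n)) x)} \<subseteq> hit j u v"
      proof (clarsimp simp: hit_def)
        fix x n assume n: "Suc 0 \<le> n" "real n \<le> f ((T ^^ n) x) * g ((T ^^ (2 * n)) x)"
        have "real (Suc j) * real n \<le> real (Suc j) * (real (Suc j) * real n)"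
          by (intro mult_left_mono) (auto simp: mult_le_cancel_right1)
        also have "\<dots> \<le> real (Suc j) * (real (Suc j) * (f ((T ^^ n) x) * g ((T ^^ (2 * n)) x)))"
          using n by (intro mult_left_mono) auto
        also have "\<dots> = u ((T ^^ n) x) * v ((T ^^ (2 * n)) x)" by (simp add: u_def v_def)
        finally show "\<exists>n\<ge>Suc 0. (1 + real j) * real n \<le> u ((T ^^ n) x) * v ((T ^^ (2 * n)) x)"
          using n(1) by auto
      qed
      moreover have "hit j u v \<in> sets M" unfolding hit_def u_def v_def by measurable
      ultimately show ?thesis using large finite_measure_mono order_trans by blast
    qed
    ultimately show ?thesis by blast
  qed
  then obtain u v where u: "\<And>j. u j \<in> L1_plus M" "\<And>j. integral\<^sup>L M (u j) \<le> (1 / 2) ^ j"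
    and v: "\<And>j. v j \<in> L1_plus M" "\<And>j. integral\<^sup>L M (v j) \<le> (1 / 2) ^ j"
    and large: "\<And>j. m / 32 \<le> measure M (hit j (u j) (v j))"
    by metis
  obtain f where f: "f \<in> L1_plus M" "AE x in M. \<forall>j. u j x \<le> f x"
    using L1_plus_dominates_sequence[OF u] by blast
  obtain g where g: "g \<in> L1_plus M" "AE x in M. \<forall>j. v j x \<le> g x"
    using L1_plus_dominates_sequence[OF v] by blast
  have [measurable]: "u j \<in> borel_measurable M" "v j \<in> borel_measurable M" for j
    using u(1)[of j] v(1)[of j] by (auto simp: L1_plus_def)
  have hit_sets: "hit j (u j) (v j) \<in> sets M" for j unfolding hit_def by measurable
  define Z where "Z = {x \<in> space M. \<exists>\<^sub>\<infinity>j. x \<in> hit j (u j) (v j)}"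
  have "m / 32 \<le> measure M Z"
    unfolding Z_def by (rule measure_infinitely_often[OF hit_sets large])
  then have Z: "measure M Z \<noteq> 0" using m by linarith
  have "\<not> (AE x in M. R_star T f g x < \<infinity>)"
  proof
    assume finite: "AE x in M. R_star T f g x < \<infinity>"
    have "AE x in M. \<forall>n j. u j ((T ^^ n) x) \<le> f ((T ^^ n) x)"
      "AE x in M. \<forall>n j. v j ((T ^^ n) x) \<le> g ((T ^^ n) x)"
      using AE_funpow[OF f(2)] AE_funpow[OF g(2)] by (simp_all add: AE_all_countable)
    with finite have "AE x in M. x \<notin> Z"
    proof eventually_elim
      fix x assume R: "R_star T f g x < \<infinity>"
        and uf: "\<forall>n j. u j ((T ^^ n) x) \<le> f ((T ^^ n) x)"
        and vg: "\<forall>n j. v j ((T ^^ n) x) \<le> g ((T ^^ n) x)"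
      show "x \<notin> Z"
      proof
        assume x: "x \<in> Z"
        then have xs: "x \<in> space M" by (simp add: Z_def)
        obtain K :: nat where K: "R_star T f g x < of_nat K"
          using R ennreal_Ex_less_of_nat[of "R_star T f g x"] by auto
        obtain j where j: "K \<le> j" "x \<in> hit j (u j) (v j)"
          using x by (auto simp: Z_def INFM_nat_le)
        then obtain n where n: "1 \<le> n" "real (Suc j) * real n \<le> u j ((T ^^ n) x) * v j ((T ^^ (2 * n)) x)"
          by (auto simp: hit_def)
        have "0 \<le> v j ((T ^^ (2 * n)) x)" "0 \<le> f ((T ^^ n) x)"
          using v(1)[of j] f(1) funpow_in_space[OF xs] by (auto simp: L1_plus_def)
        then have "u j ((T ^^ n) x) * v j ((T ^^ (2 * n)) x) \<le> f ((T ^^ n) x) * g ((T ^^ (2 * n)) x)"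
          using uf vg by (intro mult_mono) auto
        then have "real (Suc j) \<le> f ((T ^^ n) x) * g ((T ^^ (2 * n)) x) / real n"
          using n by (simp add: pos_le_divide_eq)
        then have "ennreal (real (Suc j)) \<le> ennreal (f ((T ^^ n) x) * g ((T ^^ (2 * n)) x) / real n)"
          by (rule ennreal_leI)
        also have "\<dots> \<le> R_star T f g x"
          unfolding R_star_def using n(1) by (intro SUP_upper) auto
        also have "\<dots> < of_nat K" by (rule K)
        also have "\<dots> = ennreal (real K)" by (rule ennreal_of_nat_eq_real_of_nat)
        finally have "real (Suc j) < real K" by (simp add: ennreal_less_iff del: of_nat_Suc)
        then show False using j(1) by simp
      qed
    qed
    moreover have "Z \<in> sets M" using hit_sets unfolding Z_def INFM_nat_le by measurable
    ultimately have "Z \<in> null_sets M" by (simp add: AE_iff_null_sets)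
    then show False using Z by (auto simp: measure_def)
  qed
  then show ?thesis using f(1) g(1) by blast
qed

end
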